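(* Let $p>2$. The non-negative minimizer of $I_p$ over $X_p$ is unique.
   Context: For $p>2$, $$X_p=\Big\{f\in W^{1,p}_{\mathrm{loc}}(0,\infty):\ \int_0^\infty\big(|f'|^2+\tfrac{f^2}{r^2}\big)^{p/2}\,r\,dr<\infty\Big\}$$ (real-valued functions; every $f\in X_p$ has a continuous representative on $[0,\infty)$ with $f(0)=0$), and $$I_p(f)=\int_0^\infty\Big\{\Big[(f')^2+\frac{f^2}{r^2}\Big]^{p/2}+\frac12(1-f^2)^2\Big\}\,r\,dr.$$ *)

theory Defs
  imports "HOL-Analysis.Analysis"
begin

definition locally_Lp :: "real \<Rightarrow> real set \<Rightarrow> (real \<Rightarrow> real) set" where
  "locally_Lp p S = {f \<in> borel_measurable (lebesgue_on S).
     \<forall>K. compact K \<and> K \<subseteq> S \<longrightarrow> integrable (lebesgue_on K) (\<lambda>x. \<bar>f x\<bar> powr p)}"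

definition test_functions :: "real set \<Rightarrow> (real \<Rightarrow> real) set" where
  "test_functions S = {\<phi>. (\<forall>n x. (deriv ^^ n) \<phi> differentiable (at x)) \<and>
     compact (closure {x. \<phi> x \<noteq> 0}) \<and> closure {x. \<phi> x \<noteq> 0} \<subseteq> S}"

definition has_weak_deriv :: "(real \<Rightarrow> real) \<Rightarrow> (real \<Rightarrow> real) \<Rightarrow> real set \<Rightarrow> bool" where
  "has_weak_deriv f g S \<longleftrightarrow> f \<in> locally_Lp 1 S \<and> g \<in> locally_Lp 1 S \<and>
     (\<forall>\<phi> \<in> test_functions S.
        (LINT x|lebesgue_on S. f x * deriv \<phi> x) = - (LINT x|lebesgue_on S. g x * \<phi> x))"

text \<open>A weak derivative on an open set is determined only up to null sets, so \<open>weak_deriv\<close>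
  picks a representative; the functionals below do not depend on the choice.\<close>

definition weak_deriv :: "real set \<Rightarrow> (real \<Rightarrow> real) \<Rightarrow> real \<Rightarrow> real" where
  "weak_deriv S f = (SOME g. has_weak_deriv f g S)"

definition W1p_loc :: "real \<Rightarrow> real set \<Rightarrow> (real \<Rightarrow> real) set" where
  "W1p_loc p S = {f \<in> locally_Lp p S. \<exists>g \<in> locally_Lp p S. has_weak_deriv f g S}"

text \<open>Elements of \<open>X_p\<close> are representatives of the almost-everywhere classes on \<open>(0,\<infinity>)\<close>;
  equality in the function space is equality almost everywhere there.\<close>

definition X_p :: "real \<Rightarrow> (real \<Rightarrow> real) set" where
  "X_p p = {f \<in> W1p_loc p {0<..}.
     (\<integral>\<^sup>+ r. ennreal ((\<bar>weak_deriv {0<..} f r\<bar>\<^sup>2 + (f r)\<^sup>2 / r\<^sup>2) powr (p / 2) * r)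
        \<partial>lebesgue_on {0<..}) < \<infinity>}"

text \<open>The integrand is non-negative and \<open>(1 - f\<^sup>2)\<^sup>2 r\<close> need not be integrable for \<open>f\<close> in
  \<open>X_p\<close>, so the energy takes values in \<open>[0,\<infinity>]\<close>.\<close>

definition I_p :: "real \<Rightarrow> (real \<Rightarrow> real) \<Rightarrow> ennreal" where
  "I_p p f = (\<integral>\<^sup>+ r. ennreal
     ((((weak_deriv {0<..} f r)\<^sup>2 + (f r)\<^sup>2 / r\<^sup>2) powr (p / 2) + 1 / 2 * (1 - (f r)\<^sup>2)\<^sup>2) * r)
        \<partial>lebesgue_on {0<..})"

definition nonneg_minimizer :: "real \<Rightarrow> (real \<Rightarrow> real) \<Rightarrow> bool" where
  "nonneg_minimizer p f \<longleftrightarrow>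
     is_arg_min (I_p p) (\<lambda>h. h \<in> X_p p) f \<and> (AE r in lebesgue_on {0<..}. 0 \<le> f r)"

end

theory Submission
  imports Defs
begin

text \<open>If \<open>f\<close> and \<open>g\<close> are minimizers, compare them with their quadratic mean
  \<open>h = sqrt ((f\<^sup>2 + g\<^sup>2) / 2)\<close>. By Cauchy-Schwarz \<open>h'\<^sup>2 \<le> (f'\<^sup>2 + g'\<^sup>2) / 2\<close>, so the
  gradient term of \<open>h\<close> is at most the average of those of \<open>f\<close> and \<open>g\<close>, while the potential
  is strictly convex in \<open>f\<^sup>2\<close>: it falls below the average by \<open>(f\<^sup>2 - g\<^sup>2)\<^sup>2 / 8\<close>. As the
  minimal energy is finite (\<open>min r 1\<close> has finite energy), \<open>f\<^sup>2 = g\<^sup>2\<close> almost everywhere.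

  To see that \<open>h\<close> is admissible one passes from weak derivatives to indefinite integrals (lemma of
  du Bois-Reymond) and back; \<open>h\<close> is differentiated as the limit of
  \<open>sqrt ((f\<^sup>2 + g\<^sup>2) / 2 + \<epsilon>)\<close>, where the square root is smooth.\<close>

text \<open>The quadratic mean is chosen because (1 - s^2)^2 is not convex in s but is convex in
  s^2, and passing to squares keeps the gradient term convex as well; the arithmetic mean of two
  minimizers would give no control on the potential. The price is a square root, which is not
  differentiable at 0, and nothing rules out in advance that two minimizers vanish at a common
  point.

  The second obstacle is that \<open>weak_deriv\<close> is an arbitrary choice. It is traded for an
  explicit pair: a continuous function together with a locally integrable \<open>k\<close> whose
  integral over each [a, b] is the increment of that function. All calculus is done on such pairs,
  without pointwise derivatives almost everywhere.

  Strict inequality p > 2 is what makes the tail of the comparison function min r 1 integrable: its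
  energy density there is r^(1 - p). Non-negativity enters at the very end, to pass from equal
  squares to equal functions.\<close>

section \<open>Smooth test functions\<close>

text \<open>A family containing exp(-1/x), extended by 0, that is closed under differentiation. The
  polynomial in 1/x is carried along so that smoothness of all members follows by one
  induction.\<close>

definition flat :: "real poly \<Rightarrow> real \<Rightarrow> real" where
  "flat P x = (if 0 < x then poly P (1 / x) * exp (- (1 / x)) else 0)"

lemma poly_div_exp_tendsto_0: "((\<lambda>y. poly P y / exp y) \<longlongrightarrow> (0::real)) at_top"
proof -
  have "((\<lambda>y. \<Sum>i\<le>degree P. coeff P i * (y ^ i / exp y)) \<longlongrightarrow> 0) at_top"
    by (rule tendsto_null_sum) (rule tendsto_mult_right_zero[OF tendsto_power_div_exp_0])
  then show ?thesis
    by (simp add: poly_altdef sum_divide_distrib)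
qed

lemma flat_tendsto_0: "(flat P \<longlongrightarrow> 0) (at 0)"
proof (rule filterlim_split_at)
  show "(flat P \<longlongrightarrow> 0) (at_left 0)"
    by (rule tendsto_eventually)
      (auto simp: flat_def eventually_at_filter)
  have "((\<lambda>x. poly P (inverse x) / exp (inverse x)) \<longlongrightarrow> 0) (at_right 0)"
    by (rule filterlim_compose[OF poly_div_exp_tendsto_0 filterlim_inverse_at_top_right])
  then show "(flat P \<longlongrightarrow> 0) (at_right 0)"
    by (rule Lim_transform_eventually)
      (auto simp: flat_def eventually_at_filter exp_minus field_simps)
qed

text \<open>With y = 1/x, so that dy/dx = -y^2, the derivative of P(y) exp(-y) is y^2 (P(y) - P'(y))
  exp(-y); \<open>[:0, 0, 1:]\<close> is y^2.\<close>

lemma flat_DERIV: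
  "(flat P has_real_derivative flat ([:0, 0, 1:] * (P - pderiv P)) x) (at x)"
proof -
  consider "x > 0" | "x < 0" | "x = 0" by linarith
  then show ?thesis
  proof cases
    case 1
    have "((\<lambda>x. poly P (1 / x) * exp (- (1 / x))) has_real_derivative
        flat ([:0, 0, 1:] * (P - pderiv P)) x) (at x)"
    proof -
      have "((\<lambda>x. 1 / x) has_real_derivative - (1 / x ^ 2)) (at x)"
        using 1 by (auto intro!: derivative_eq_intros simp: power2_eq_square)
      note d = this
      have "((\<lambda>x. poly P (1 / x) * exp (- (1 / x))) has_real_derivative
          poly (pderiv P) (1 / x) * (- (1 / x ^ 2)) * exp (- (1 / x))
          + exp (- (1 / x)) * - (- (1 / x ^ 2)) * poly P (1 / x)) (at x)"
        by (intro DERIV_mult DERIV_chain2[OF poly_DERIV d] DERIV_chain2[OF DERIV_exp] DERIV_minus d)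
      then show ?thesis
        using 1 by (simp add: flat_def algebra_simps power2_eq_square)
    qed
    then show ?thesis
      by (rule has_field_derivative_transform_within_open[where S = "{0<..}"])
        (use 1 in \<open>auto simp: flat_def\<close>)
  next
    case 2
    have "((\<lambda>_. 0) has_real_derivative flat ([:0, 0, 1:] * (P - pderiv P)) x) (at x)"
      using 2 by (simp add: flat_def)
    then show ?thesis
      by (rule has_field_derivative_transform_within_open[where S = "{..<0}"])
        (use 2 in \<open>auto simp: flat_def\<close>)
  next
    case 3
    \<comment> \<open>Dividing by h multiplies the polynomial by y = 1/h, so the difference quotient
      at 0 is again a \<open>flat\<close> function and tends to 0.\<close>
    have "((\<lambda>h. (flat P (0 + h) - flat P 0) / h) \<longlongrightarrow> 0) (at 0)"
      by (rule Lim_transform_eventually[OF flat_tendsto_0[of "[:0, 1:] * P"]])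
        (auto simp: flat_def eventually_at_filter field_simps)
    then show ?thesis
      using 3 by (simp add: DERIV_def flat_def)
  qed
qed

text \<open>A finite-order form of smoothness that peels off the innermost derivative. Closure under
  sums and products then follows by induction on the order, with the functions generalised.\<close>

fun n_diff :: "nat \<Rightarrow> (real \<Rightarrow> real) \<Rightarrow> bool" where
  "n_diff 0 f = True"
| "n_diff (Suc n) f = ((\<forall>x. f differentiable (at x)) \<and> n_diff n (deriv f))"

lemma n_diff_iff: "n_diff n f \<longleftrightarrow> (\<forall>k<n. \<forall>x. (deriv ^^ k) f differentiable (at x))"
proof (induction n arbitrary: f)
  case (Suc n)
  have "(deriv ^^ Suc k) f = (deriv ^^ k) (deriv f)" for k
    by (simp only: funpow_Suc_right o_apply)
  then show ?case
    unfolding All_less_Suc2 n_diff.simps Suc by simp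
qed simp

lemma n_diff_Suc_imp: "n_diff (Suc n) f \<Longrightarrow> n_diff n f"
  by (induction n arbitrary: f) auto

lemma differentiable_imp_DERIV: "f differentiable (at x) \<Longrightarrow> (f has_real_derivative deriv f x) (at x)"
  for f :: "real \<Rightarrow> real"
  by (simp add: DERIV_deriv_iff_real_differentiable)

lemma n_diff_SucI:
  assumes "\<And>x. (f has_real_derivative f' x) (at x)" "n_diff n f'"
  shows "n_diff (Suc n) f"
proof -
  have "deriv f = f'"
    using assms(1) by (auto intro!: DERIV_imp_deriv)
  then show ?thesis
    using assms by (auto simp: real_differentiable_def)
qed

lemma n_diff_add: "n_diff n f \<Longrightarrow> n_diff n g \<Longrightarrow> n_diff n (\<lambda>x. f x + g x)"
proof (induction n arbitrary: f g)
  case (Suc n)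
  then show ?case
    by (intro n_diff_SucI[where f' = "\<lambda>x. deriv f x + deriv g x"])
      (auto intro!: DERIV_add differentiable_imp_DERIV)
qed simp

lemma n_diff_mult: "n_diff n f \<Longrightarrow> n_diff n g \<Longrightarrow> n_diff n (\<lambda>x. f x * g x)"
proof (induction n arbitrary: f g)
  case (Suc n)
  have "n_diff n (\<lambda>x. deriv f x * g x + deriv g x * f x)"
    using Suc.prems by (intro n_diff_add Suc.IH) (auto intro: n_diff_Suc_imp)
  then show ?case
    using Suc.prems by (intro n_diff_SucI[where f' = "\<lambda>x. deriv f x * g x + deriv g x * f x"])
      (auto intro!: DERIV_mult differentiable_imp_DERIV)
qed simp

lemma n_diff_const: "n_diff n (\<lambda>_. c)"
proof (induction n arbitrary: c)
  case (Suc n)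
  show ?case by (rule n_diff_SucI[of _ "\<lambda>_. 0"]) (simp_all add: Suc)
qed simp

lemma n_diff_affine: "n_diff n f \<Longrightarrow> n_diff n (\<lambda>x. f (c * x + d))"
proof (induction n arbitrary: f)
  case (Suc n)
  have "((\<lambda>x. f (c * x + d)) has_real_derivative deriv f (c * x + d) * c) (at x)" for x
    using Suc.prems
    by (intro DERIV_chain2[where f = f and g = "\<lambda>x. c * x + d"] differentiable_imp_DERIV)
      (auto intro!: derivative_eq_intros)
  moreover have "n_diff n (\<lambda>x. deriv f (c * x + d) * c)"
    using Suc by (intro n_diff_mult n_diff_const) auto
  ultimately show ?case
    by (rule n_diff_SucI)
qed simp

lemma n_diff_flat: "n_diff n (flat P)"
  by (induction n arbitrary: P) (simp, blast intro: n_diff_SucI flat_DERIV)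

section \<open>Test functions on the half-line and their supports\<close>

lemma test_functionsI:
  assumes "\<And>n. n_diff n \<phi>" "\<And>x. x \<notin> {a..b} \<Longrightarrow> \<phi> x = 0" "0 < a"
  shows "\<phi> \<in> test_functions {0<..}"
proof -
  have "closure {x. \<phi> x \<noteq> 0} \<subseteq> {a..b}"
    by (rule closure_minimal) (use assms(2) in blast, simp)
  moreover have "compact (closure {x. \<phi> x \<noteq> 0})"
    using calculation compact_Icc by (metis closed_closure compact_Int_closed inf.absorb_iff2)
  ultimately show ?thesis
    using assms(1,3) by (force simp: test_functions_def n_diff_iff)
qed

lemma test_functionsD:
  assumes "\<phi> \<in> test_functions {0<..}"
  shows "n_diff n \<phi>" "(\<phi> has_real_derivative deriv \<phi> x) (at x)" "continuous_on S (deriv \<phi>)"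
proof -
  show n: "n_diff n \<phi>" for n
    using assms by (auto simp: test_functions_def n_diff_iff)
  show "(\<phi> has_real_derivative deriv \<phi> x) (at x)"
    using n[of 1] by (auto intro: differentiable_imp_DERIV)
  show "continuous_on S (deriv \<phi>)"
    using n[of 2]
    by (auto simp: numeral_2_eq_2 intro!: continuous_at_imp_continuous_on differentiable_imp_continuous_within)
qed

lemma deriv_eq_0_outside:
  fixes \<phi> :: "real \<Rightarrow> real"
  assumes "\<And>x. x \<notin> {a..b} \<Longrightarrow> \<phi> x = 0" "x \<notin> {a..b}"
  shows "deriv \<phi> x = 0"
proof -
  have "((\<lambda>_. 0) has_real_derivative 0) (at x)"
    by simp
  then have "(\<phi> has_real_derivative 0) (at x)"
    by (rule has_field_derivative_transform_within_open[where S = "- {a..b}"])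
      (use assms in auto)
  then show ?thesis
    by (rule DERIV_imp_deriv)
qed

lemma compact_subset_pos_Icc:
  fixes K :: "real set"
  assumes "compact K" "K \<subseteq> {0<..}"
  obtains a b where "0 < a" "K \<subseteq> {a..b}"
proof (cases "K = {}")
  case False
  obtain c where c: "c \<in> K" "\<And>x. x \<in> K \<Longrightarrow> c \<le> x"
    using compact_attains_inf[OF assms(1) False] by auto
  obtain d where d: "d \<in> K" "\<And>x. x \<in> K \<Longrightarrow> x \<le> d"
    using compact_attains_sup[OF assms(1) False] by auto
  show ?thesis
    by (rule that[of c d]) (use c d assms(2) in auto)
qed (use that[of 1 1] in auto)

lemma test_functions_support:
  assumes "\<phi> \<in> test_functions {0<..}"
  obtains a b where "0 < a" "a < b" "\<And>x. x \<notin> {a<..<b} \<Longrightarrow> \<phi> x = 0"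
    "\<And>x. x \<notin> {a<..<b} \<Longrightarrow> deriv \<phi> x = 0"
proof -
  define K where "K = closure {x. \<phi> x \<noteq> 0}"
  have K: "compact K" "K \<subseteq> {0<..}" and sub: "{x. \<phi> x \<noteq> 0} \<subseteq> K"
    using assms by (auto simp: test_functions_def K_def intro: closure_subset[THEN subsetD])
  obtain c d where cd: "0 < c" "K \<subseteq> {c..d}"
    using compact_subset_pos_Icc[OF K] .
  have z: "\<phi> x = 0" if "x \<notin> {c..d}" for x
    using that sub cd by auto
  show ?thesis
  proof
    \<comment> \<open>The support is widened so that values and derivatives vanish at both endpoints
      as well; \<open>max c d\<close> guards against d < c, which is possible for an empty
      support.\<close>
    have out: "x \<notin> {c..d}" if "x \<notin> {c / 2<..<max c d + 1}" for x
      using that cd(1) by auto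
    show "\<phi> x = 0" "deriv \<phi> x = 0" if "x \<notin> {c / 2<..<max c d + 1}" for x
      using z deriv_eq_0_outside[of c d \<phi> x] out[OF that] by blast+
  qed (use cd in auto)
qed

text \<open>A smooth substitute for the indicator of (a, b): it is supported in [a, b], bounded by
  1, and tends to 1 inside as n grows, because each exponent carries a factor 1/(n + 1).\<close>

definition bump :: "real \<Rightarrow> real \<Rightarrow> nat \<Rightarrow> real \<Rightarrow> real" where
  "bump a b n x = flat 1 (real (Suc n) * (x - a)) * flat 1 (real (Suc n) * (b - x))"

lemma bump_test_function:
  assumes "0 < a"
  shows "bump a b n \<in> test_functions {0<..}"
proof (rule test_functionsI[of _ a b])
  show "n_diff k (bump a b n)" for k
    using n_diff_mult[OF n_diff_affine[OF n_diff_flat[of k 1], of "real (Suc n)" "- real (Suc n) * a"]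
        n_diff_affine[OF n_diff_flat[of k 1], of "- real (Suc n)" "real (Suc n) * b"]]
    unfolding bump_def by (simp add: algebra_simps)
  show "bump a b n x = 0" if "x \<notin> {a..b}" for x
    using that by (auto simp: bump_def flat_def zero_less_mult_iff)
qed fact

lemma bump_outside: "x \<notin> {a<..<b} \<Longrightarrow> bump a b n x = 0"
  by (auto simp: bump_def flat_def zero_less_mult_iff)

lemma bump_pos: "x \<in> {a<..<b} \<Longrightarrow> 0 < bump a b n x"
  by (auto simp: bump_def flat_def)

lemma bump_bound: "\<bar>bump a b n x\<bar> \<le> 1"
  by (auto simp: bump_def flat_def abs_mult intro!: mult_le_one)

lemma bump_tendsto:
  assumes "x \<in> {a<..<b}"
  shows "(\<lambda>n. bump a b n x) \<longlonglongrightarrow> 1"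
proof -
  have "(\<lambda>n. exp (- (1 / (real (Suc n) * y)))) \<longlonglongrightarrow> 1" if "y > 0" for y :: real
  proof -
    have "(\<lambda>n. exp (- (inverse (real (Suc n)) * inverse y))) \<longlonglongrightarrow> exp (- (0 * inverse y))"
      by (intro tendsto_intros LIMSEQ_inverse_real_of_nat)
    then show ?thesis by (simp add: field_simps)
  qed
  from tendsto_mult[OF this[of "x - a"] this[of "b - x"]] show ?thesis
    using assms by (auto simp: bump_def flat_def)
qed

section \<open>Absolutely continuous functions on the half-line\<close>

text \<open>This says that \<open>H\<close> is locally absolutely continuous on (0, \<infinity>)
  with derivative \<open>k\<close>, phrased by integrals alone. Nothing is required near 0, and
  \<open>k\<close> matters only up to null sets.\<close>

definition primitive_of :: "(real \<Rightarrow> real) \<Rightarrow> (real \<Rightarrow> real) \<Rightarrow> bool" where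
  "primitive_of k H \<longleftrightarrow> (\<forall>a b. 0 < a \<longrightarrow> a \<le> b \<longrightarrow>
     k absolutely_integrable_on {a..b} \<and> integral {a..b} k = H b - H a)"

lemma primitive_ofD:
  assumes "primitive_of k H" "0 < a"
  shows "k absolutely_integrable_on {a..b}"
    and "k integrable_on {a..b}"
    and "a \<le> b \<Longrightarrow> integral {a..b} k = H b - H a"
proof -
  show 1: "k absolutely_integrable_on {a..b}"
  proof (cases "a \<le> b")
    case False
    then have "{a..b} = {}" by simp
    then show ?thesis unfolding set_integrable_def by simp
  qed (use assms in \<open>auto simp: primitive_of_def\<close>)
  then show "k integrable_on {a..b}"
    by (simp add: absolutely_integrable_on_def)
  show "a \<le> b \<Longrightarrow> integral {a..b} k = H b - H a"
    using assms by (auto simp: primitive_of_def)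
qed

lemma primitive_of_continuous:
  assumes "primitive_of k H"
  shows "continuous_on {0<..} H"
proof -
  have "isCont H x" if "x > 0" for x
  proof -
    have "continuous_on {x/2..x+1} (\<lambda>y. H (x/2) + integral {x/2..y} k)"
      using that by (intro continuous_intros indefinite_integral_continuous_1 primitive_ofD[OF assms]) auto
    then have "continuous_on {x/2..x+1} H"
      by (rule continuous_on_eq) (use that in \<open>auto simp: primitive_ofD(3)[OF assms]\<close>)
    then show ?thesis
      using that by (intro continuous_on_interior) auto
  qed
  then show ?thesis
    by (auto intro: continuous_at_imp_continuous_on)
qed

lemma primitive_of_continuous_Icc:
  "primitive_of k H \<Longrightarrow> 0 < a \<Longrightarrow> continuous_on {a..b} H"
  by (rule continuous_on_subset[OF primitive_of_continuous]) auto

lemma primitive_ofI_has_integral: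
  assumes "\<And>a b. 0 < a \<Longrightarrow> a \<le> b \<Longrightarrow> k absolutely_integrable_on {a..b}"
    and "\<And>a b. 0 < a \<Longrightarrow> a \<le> b \<Longrightarrow> (k has_integral (H b - H a)) {a..b}"
  shows "primitive_of k H"
  using assms by (auto simp: primitive_of_def integral_unique)

lemma primitive_of_add:
  assumes "primitive_of k H" "primitive_of l G"
  shows "primitive_of (\<lambda>x. k x + l x) (\<lambda>x. H x + G x)"
  unfolding primitive_of_def
  by (auto simp: integral_add primitive_ofD[OF assms(1)] primitive_ofD[OF assms(2)])

lemma primitive_of_cmult:
  assumes "primitive_of k H"
  shows "primitive_of (\<lambda>x. c * k x) (\<lambda>x. c * H x)"
  unfolding primitive_of_def
  by (auto simp: primitive_ofD[OF assms] algebra_simps)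

lemma primitive_of_C1:
  assumes "\<And>x. x > 0 \<Longrightarrow> (\<phi> has_real_derivative \<phi>' x) (at x)" "continuous_on {0<..} \<phi>'"
  shows "primitive_of \<phi>' \<phi>"
proof (rule primitive_ofI_has_integral)
  fix a b :: real assume ab: "0 < a" "a \<le> b"
  show "\<phi>' absolutely_integrable_on {a..b}"
    by (rule absolutely_integrable_continuous_real, rule continuous_on_subset[OF assms(2)]) (use ab in auto)
  show "(\<phi>' has_integral (\<phi> b - \<phi> a)) {a..b}"
    using ab assms(1)
    by (intro fundamental_theorem_of_calculus)
      (auto intro: has_field_derivative_at_within simp flip: has_real_derivative_iff_has_vector_derivative)
qed

section \<open>Chain rule and product rule for indefinite integrals\<close>

lemma absolutely_integrable_continuous_mult:
  fixes u k :: "real \<Rightarrow> real"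
  assumes "continuous_on {a..b} u" "k absolutely_integrable_on {a..b}"
  shows "(\<lambda>x. u x * k x) absolutely_integrable_on {a..b}"
  using assms
  by (intro absolutely_integrable_bounded_measurable_product_real continuous_imp_measurable_on_sets_lebesgue
      compact_imp_bounded compact_continuous_image) auto

lemma abs_integral_mult_le:
  fixes u k :: "real \<Rightarrow> real"
  assumes "(\<lambda>x. u x * k x) absolutely_integrable_on S" "k absolutely_integrable_on S"
    and "\<And>x. x \<in> S \<Longrightarrow> \<bar>u x\<bar> \<le> e"
  shows "\<bar>integral S (\<lambda>x. u x * k x)\<bar> \<le> e * integral S (\<lambda>x. \<bar>k x\<bar>)"
proof -
  have "norm (integral S (\<lambda>x. u x * k x)) \<le> integral S (\<lambda>x. e * \<bar>k x\<bar>)"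
    using assms by (intro integral_norm_bound_integral)
      (auto simp: absolutely_integrable_on_def abs_mult intro!: mult_right_mono integrable_on_mult_right)
  then show ?thesis by simp
qed

text \<open>No differentiability of \<open>H\<close> is used: on a short interval the mean value theorem for \<open>\<Phi>\<close>
  gives the claim up to \<open>\<epsilon> \<integral>\<bar>k\<bar>\<close>, and this error is additive over adjacent intervals.\<close>

lemma primitive_of_chain:
  fixes \<Phi> \<Phi>' :: "real \<Rightarrow> real"
  assumes H: "primitive_of k H"
    and T: "is_interval T" "\<And>x. x > 0 \<Longrightarrow> H x \<in> T"
    and \<Phi>: "\<And>y. y \<in> T \<Longrightarrow> (\<Phi> has_real_derivative \<Phi>' y) (at y)"
    and \<Phi>': "continuous_on T \<Phi>'"
  shows "primitive_of (\<lambda>x. \<Phi>' (H x) * k x) (\<lambda>x. \<Phi> (H x))"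
proof -
  have cont: "continuous_on {a..b} (\<lambda>x. \<Phi>' (H x))" if "0 < a" for a b
    by (rule continuous_on_compose2[OF \<Phi>' primitive_of_continuous_Icc[OF H that]])
      (use that T in auto)
  have ai: "(\<lambda>x. \<Phi>' (H x) * k x) absolutely_integrable_on {a..b}" if "0 < a" for a b
    by (intro absolutely_integrable_continuous_mult cont primitive_ofD[OF H] that)
  have *: "\<bar>\<Phi> (H b) - \<Phi> (H a) - integral {a..b} (\<lambda>x. \<Phi>' (H x) * k x)\<bar> \<le> \<epsilon> * integral {a..b} (\<lambda>x. \<bar>k x\<bar>)"
    if ab: "0 < a" "a \<le> b" and \<epsilon>: "\<epsilon> > 0" for a b \<epsilon>
  proof -
    define V where "V u v = integral {u..v} (\<lambda>x. \<bar>k x\<bar>)" for u v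
    define D where "D u v = \<Phi> (H v) - \<Phi> (H u) - integral {u..v} (\<lambda>x. \<Phi>' (H x) * k x)" for u v
    \<comment> \<open>The rule \<open>Bolzano\<close> also asks about short intervals that stick out
      of [a, b], possibly beyond 0; the guards make the claim vacuous there.\<close>
    define P where "P u v \<longleftrightarrow> (a \<le> u \<longrightarrow> u \<le> v \<longrightarrow> v \<le> b \<longrightarrow> \<bar>D u v\<bar> \<le> \<epsilon> * V u v)" for u v
    have "P a b"
      using ab(2)
    proof (induction rule: Bolzano)
      case (trans u v w)
      show ?case
        unfolding P_def
      proof (intro impI)
        assume *: "a \<le> u" "u \<le> w" "w \<le> b"
        have "D u w = D u v + D v w"
          unfolding D_def
          using Henstock_Kurzweil_Integration.integral_combine[OF trans(3,4), of "\<lambda>x. \<Phi>' (H x) * k x"]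
            ai[of u w] * ab by (simp add: absolutely_integrable_on_def)
        moreover have "V u w = V u v + V v w"
          unfolding V_def
          using Henstock_Kurzweil_Integration.integral_combine[OF trans(3,4), of "\<lambda>x. \<bar>k x\<bar>"]
            primitive_ofD(1)[OF H, of u w] * ab by (simp add: absolutely_integrable_on_def)
        ultimately show "\<bar>D u w\<bar> \<le> \<epsilon> * V u w"
          using trans * by (simp add: P_def distrib_left)
      qed
    next
      case (local x)
      have "H x \<in> T" using local ab T by auto
      \<comment> \<open>Half of \<open>\<epsilon>\<close>, since two values of
        \<open>\<Phi>'\<close>, at an intermediate point and at \<open>H y\<close>, are both
        compared with \<open>\<Phi>' (H x)\<close>.\<close>
      then obtain \<eta> where \<eta>: "\<eta> > 0" "\<And>y. y \<in> T \<Longrightarrow> \<bar>y - H x\<bar> < \<eta> \<Longrightarrow> \<bar>\<Phi>' y - \<Phi>' (H x)\<bar> < \<epsilon> / 2"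
        using \<Phi>' \<epsilon> unfolding continuous_on_iff dist_real_def by (meson half_gt_zero)
      obtain d where d: "d > 0" "\<And>y. y \<in> {a..b} \<Longrightarrow> \<bar>y - x\<bar> < d \<Longrightarrow> \<bar>H y - H x\<bar> < \<eta>"
        using primitive_of_continuous_Icc[OF H ab(1), of b] \<eta>(1) local
        unfolding continuous_on_iff dist_real_def by (meson atLeastAtMost_iff)
      have "P u v" if uv': "u \<le> x" "x \<le> v" "v - u < d" for u v
        unfolding P_def
      proof (intro impI)
        assume "a \<le> u" "u \<le> v" "v \<le> b"
        note uv = uv' this
        have pos: "0 < u" "u \<le> v" using uv ab by auto
        have near: "\<bar>H y - H x\<bar> < \<eta>" "H y \<in> T" if "y \<in> {u..v}" for y
        proof -
          have "\<bar>y - x\<bar> < d" "y \<in> {a..b}" "0 < y"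
            using that uv pos unfolding atLeastAtMost_iff by linarith+
          then show "\<bar>H y - H x\<bar> < \<eta>" "H y \<in> T"
            using d(2) T(2) by blast+
        qed
        \<comment> \<open>The mean value theorem is applied on the range side, between the values
          \<open>H u\<close> and \<open>H v\<close>. These may come in either order or coincide, and
          \<open>\<xi>\<close> stays in \<open>T\<close> because \<open>T\<close> is an
          interval.\<close>
        have "\<exists>\<xi>\<in>T. \<bar>\<xi> - H x\<bar> < \<eta> \<and> \<Phi> (H v) - \<Phi> (H u) = (H v - H u) * \<Phi>' \<xi>"
        proof -
          have mvt: "\<exists>\<xi>. \<alpha> \<le> \<xi> \<and> \<xi> \<le> \<beta> \<and> \<Phi> \<beta> - \<Phi> \<alpha> = (\<beta> - \<alpha>) * \<Phi>' \<xi>"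
            if "\<alpha> \<in> T" "\<beta> \<in> T" "\<alpha> < \<beta>" for \<alpha> \<beta>
          proof -
            have "\<exists>\<xi>. \<alpha> < \<xi> \<and> \<xi> < \<beta> \<and> \<Phi> \<beta> - \<Phi> \<alpha> = (\<beta> - \<alpha>) * \<Phi>' \<xi>"
              using that(3) by (rule MVT2) (rule \<Phi>, rule mem_is_interval_1_I[OF T(1) that(1,2)])
            then show ?thesis by (meson less_imp_le)
          qed
          have nu: "\<bar>H u - H x\<bar> < \<eta>" "H u \<in> T" and nv: "\<bar>H v - H x\<bar> < \<eta>" "H v \<in> T"
            using near[of u] near[of v] pos by auto
          consider "H u = H v" | "H u < H v" | "H v < H u" by linarith
          then show ?thesis
          proof cases
            case 1
            then show ?thesis using nu by (intro bexI[of _ "H u"]) auto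
          next
            case 2
            obtain \<xi> where \<xi>: "H u \<le> \<xi>" "\<xi> \<le> H v" "\<Phi> (H v) - \<Phi> (H u) = (H v - H u) * \<Phi>' \<xi>"
              using mvt[OF nu(2) nv(2) 2] by auto
            moreover have "\<xi> \<in> T" by (rule mem_is_interval_1_I[OF T(1) nu(2) nv(2) \<xi>(1,2)])
            ultimately show ?thesis using nu nv by (intro bexI[of _ \<xi>]) auto
          next
            case 3
            obtain \<xi> where \<xi>: "H v \<le> \<xi>" "\<xi> \<le> H u" "\<Phi> (H u) - \<Phi> (H v) = (H u - H v) * \<Phi>' \<xi>"
              using mvt[OF nv(2) nu(2) 3] by auto
            moreover have "\<xi> \<in> T" by (rule mem_is_interval_1_I[OF T(1) nv(2) nu(2) \<xi>(1,2)])
            ultimately show ?thesis using nu nv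
              by (intro bexI[of _ \<xi>]) (auto simp: algebra_simps)
          qed
        qed
        then obtain \<xi> where \<xi>: "\<xi> \<in> T" "\<bar>\<xi> - H x\<bar> < \<eta>" "\<Phi> (H v) - \<Phi> (H u) = (H v - H u) * \<Phi>' \<xi>"
          by auto
        have k: "k integrable_on {u..v}" "(\<lambda>x. \<Phi>' (H x) * k x) integrable_on {u..v}"
          using primitive_ofD(2)[OF H pos(1)] ai[OF pos(1)] by (auto simp: absolutely_integrable_on_def)
        have "D u v = \<Phi>' \<xi> * integral {u..v} k - integral {u..v} (\<lambda>x. \<Phi>' (H x) * k x)"
          using primitive_ofD(3)[OF H pos] \<xi>(3) by (simp add: D_def)
        also have "\<dots> = integral {u..v} (\<lambda>x. \<Phi>' \<xi> * k x - \<Phi>' (H x) * k x)"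
          using k by (subst integral_diff) (auto intro: integrable_on_mult_right)
        also have "\<dots> = integral {u..v} (\<lambda>x. (\<Phi>' \<xi> - \<Phi>' (H x)) * k x)"
          by (simp add: algebra_simps)
        finally have D: "D u v = \<dots>" .
        have "\<bar>integral {u..v} (\<lambda>x. (\<Phi>' \<xi> - \<Phi>' (H x)) * k x)\<bar> \<le> \<epsilon> * V u v"
          unfolding V_def
        proof (rule abs_integral_mult_le)
          show "(\<lambda>x. (\<Phi>' \<xi> - \<Phi>' (H x)) * k x) absolutely_integrable_on {u..v}"
            by (intro absolutely_integrable_continuous_mult continuous_intros cont pos primitive_ofD[OF H])
          show "k absolutely_integrable_on {u..v}"
            by (intro pos primitive_ofD[OF H])
          show "\<bar>\<Phi>' \<xi> - \<Phi>' (H y)\<bar> \<le> \<epsilon>" if "y \<in> {u..v}" for y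
            using \<eta>(2)[OF \<xi>(1,2)] \<eta>(2)[OF near(2,1)[OF that]] by linarith
        qed
        then show "\<bar>D u v\<bar> \<le> \<epsilon> * V u v" using D by simp
      qed
      then show ?case using d(1) by blast
    qed
    then show ?thesis using ab by (simp add: P_def D_def V_def)
  qed
  show ?thesis
    unfolding primitive_of_def
  proof (intro allI impI conjI ai)
    fix a b :: real assume ab: "0 < a" "a \<le> b"
    define V where "V = integral {a..b} (\<lambda>x. \<bar>k x\<bar>)"
    have "V \<ge> 0"
      unfolding V_def by (rule Henstock_Kurzweil_Integration.integral_nonneg)
       (use primitive_ofD(1)[OF H ab(1)] in \<open>auto simp: absolutely_integrable_on_def\<close>)
    define D where "D = \<bar>\<Phi> (H b) - \<Phi> (H a) - integral {a..b} (\<lambda>x. \<Phi>' (H x) * k x)\<bar>"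
    have "D \<le> 0"
    proof (rule field_le_epsilon)
      fix e :: real assume "0 < e"
      \<comment> \<open>The denominator is V + 1 because V may be 0.\<close>
      then have "D \<le> e / (V + 1) * V"
        using *[OF ab, of "e / (V + 1)"] \<open>V \<ge> 0\<close> unfolding V_def[symmetric] D_def[symmetric]
        by (simp add: add_nonneg_pos)
      also have "\<dots> \<le> 0 + e"
        using \<open>0 < e\<close> \<open>V \<ge> 0\<close> by (simp add: field_simps)
      finally show "D \<le> 0 + e" .
    qed
    then show "integral {a..b} (\<lambda>x. \<Phi>' (H x) * k x) = \<Phi> (H b) - \<Phi> (H a)"
      by (simp add: D_def)
  qed
qed

lemma primitive_of_power2:
  assumes "primitive_of k H"
  shows "primitive_of (\<lambda>x. 2 * H x * k x) (\<lambda>x. (H x)\<^sup>2)"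
  by (rule primitive_of_chain[OF assms, where T = UNIV and \<Phi> = "\<lambda>y. y\<^sup>2" and \<Phi>' = "\<lambda>y. 2 * y"])
    (auto intro!: derivative_eq_intros continuous_intros)

text \<open>Polarisation, 4 H G = (H + G)^2 - (H - G)^2, reduces the product rule to the chain rule
  for squares.\<close>

lemma primitive_of_mult:
  assumes "primitive_of k H" "primitive_of l G"
  shows "primitive_of (\<lambda>x. k x * G x + H x * l x) (\<lambda>x. H x * G x)"
proof -
  have "primitive_of (\<lambda>x. k x + (-1) * l x) (\<lambda>x. H x + (-1) * G x)"
    by (intro primitive_of_add primitive_of_cmult assms)
  note minus = primitive_of_power2[OF this]
  note plus = primitive_of_power2[OF primitive_of_add[OF assms]]
  have "primitive_of (\<lambda>x. (1/4) * (2 * (H x + G x) * (k x + l x)) + (-1/4) * (2 * (H x + (-1) * G x) * (k x + (-1) * l x)))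
     (\<lambda>x. (1/4) * (H x + G x)\<^sup>2 + (-1/4) * (H x + (-1) * G x)\<^sup>2)"
    by (intro primitive_of_add primitive_of_cmult plus minus)
  then show ?thesis
    by (simp add: power2_eq_square algebra_simps)
qed

section \<open>Weak derivatives on the half-line\<close>

text \<open>The bridge between the Lebesgue integral in the definition of weak derivatives and the
  gauge integral over [a, b], in which the calculus is done.\<close>

lemma integral_lebesgue_on_pos_eq:
  fixes F :: "real \<Rightarrow> real"
  assumes "0 < a" "F absolutely_integrable_on {a..b}" "\<And>x. x \<notin> {a..b} \<Longrightarrow> F x = 0"
  shows "integrable (lebesgue_on {0<..}) F" "(LINT x|lebesgue_on {0<..}. F x) = integral {a..b} F"
proof -
  have ind: "(\<lambda>x. indicator {0<..} x *\<^sub>R F x) = (\<lambda>x. indicator {a..b} x *\<^sub>R F x)"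
    using assms(1,3) by (force simp: indicator_def)
  show i: "integrable (lebesgue_on {0<..}) F"
    using assms(2) by (simp add: integrable_restrict_space set_integrable_def ind del: real_scaleR_def)
  have "integral {0<..} F = integral {a..b} F"
    using assms(1,3) by (intro integral_spike_set) (auto intro: negligible_subset[OF negligible_empty])
  then show "(LINT x|lebesgue_on {0<..}. F x) = integral {a..b} F"
    using i by (simp add: lebesgue_integral_eq_integral)
qed

lemma locally_Lp_iff:
  "f \<in> locally_Lp p {0<..} \<longleftrightarrow> f \<in> borel_measurable (lebesgue_on {0<..}) \<and>
    (\<forall>a b. 0 < a \<longrightarrow> (\<lambda>x. \<bar>f x\<bar> powr p) absolutely_integrable_on {a..b})"
proof -
  have "integrable (lebesgue_on K) (\<lambda>x. \<bar>f x\<bar> powr p) \<longleftrightarrow> (\<lambda>x. \<bar>f x\<bar> powr p) absolutely_integrable_on K"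
    if "compact K" for K
    using lmeasurable_compact[OF that, THEN fmeasurableD]
    by (simp add: integrable_restrict_space set_integrable_def)
  moreover have "(\<lambda>x. \<bar>f x\<bar> powr p) absolutely_integrable_on K"
    if "compact K" "K \<subseteq> {0<..}"
      and *: "\<forall>a b. 0 < a \<longrightarrow> (\<lambda>x. \<bar>f x\<bar> powr p) absolutely_integrable_on {a..b}" for K
  proof -
    obtain a b where "0 < a" "K \<subseteq> {a..b}"
      using compact_subset_pos_Icc[OF \<open>compact K\<close> \<open>K \<subseteq> {0<..}\<close>] by blast
    then show ?thesis
      using * lmeasurable_compact[OF \<open>compact K\<close>, THEN fmeasurableD]
      by (metis set_integrable_subset)
  qed
  moreover have "compact {a..b}" "0 < a \<Longrightarrow> {a..b} \<subseteq> {0<..}" for a b :: real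
    by auto
  ultimately show ?thesis
    unfolding locally_Lp_def mem_Collect_eq by metis
qed

lemma borel_measurable_subset_lebesgue_on:
  assumes "f \<in> borel_measurable (lebesgue_on S)" "T \<subseteq> S"
  shows "f \<in> borel_measurable (lebesgue_on T)"
  by (rule measurable_restrict_mono[OF assms])

lemma locally_L1_iff:
  "f \<in> locally_Lp 1 {0<..} \<longleftrightarrow> f \<in> borel_measurable (lebesgue_on {0<..}) \<and>
    (\<forall>a b. 0 < a \<longrightarrow> f absolutely_integrable_on {a..b})"
proof -
  have "f absolutely_integrable_on {a..b} \<longleftrightarrow> (\<lambda>x. \<bar>f x\<bar>) absolutely_integrable_on {a..b}"
    if "f \<in> borel_measurable (lebesgue_on {0<..})" "0 < a" for a b
  proof -
    have "f \<in> borel_measurable (lebesgue_on {a..b})"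
      using that(2) by (intro borel_measurable_subset_lebesgue_on[OF that(1)]) auto
    then show ?thesis
      by (simp add: absolutely_integrable_measurable_real)
  qed
  then show ?thesis
    by (auto simp: locally_Lp_iff)
qed

lemma test_functions_continuous: "\<phi> \<in> test_functions {0<..} \<Longrightarrow> continuous_on S \<phi>"
  by (rule DERIV_continuous_on) (rule has_field_derivative_at_within, rule test_functionsD(2))

lemma integrable_mult_test_function:
  assumes u: "\<And>a b. 0 < a \<Longrightarrow> u absolutely_integrable_on {a..b}"
    and \<phi>: "\<phi> \<in> test_functions {0<..}"
  shows "integrable (lebesgue_on {0<..}) (\<lambda>x. u x * \<phi> x)"
    and "integrable (lebesgue_on {0<..}) (\<lambda>x. u x * deriv \<phi> x)"
proof -
  obtain a b where ab: "0 < a" "a < b" "\<And>x. x \<notin> {a<..<b} \<Longrightarrow> \<phi> x = 0"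
    "\<And>x. x \<notin> {a<..<b} \<Longrightarrow> deriv \<phi> x = 0"
    using test_functions_support[OF \<phi>] by blast
  have "(\<lambda>x. \<phi> x * u x) absolutely_integrable_on {a..b}"
    "(\<lambda>x. deriv \<phi> x * u x) absolutely_integrable_on {a..b}"
    by (intro absolutely_integrable_continuous_mult test_functions_continuous
        test_functionsD(3) \<phi> u ab)+
  then show "integrable (lebesgue_on {0<..}) (\<lambda>x. u x * \<phi> x)"
    "integrable (lebesgue_on {0<..}) (\<lambda>x. u x * deriv \<phi> x)"
    using ab(3,4) by (auto intro!: integral_lebesgue_on_pos_eq(1)[OF ab(1)] simp: mult.commute)
qed

text \<open>Integration by parts: \<open>H x * \<phi> x\<close> is an indefinite integral by the
  product rule and vanishes at both ends of an interval around the support.\<close>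

lemma primitive_of_weak_deriv:
  assumes "primitive_of k H" "\<phi> \<in> test_functions {0<..}"
  shows "(LINT x|lebesgue_on {0<..}. H x * deriv \<phi> x) = - (LINT x|lebesgue_on {0<..}. k x * \<phi> x)"
proof -
  obtain a b where ab: "0 < a" "a < b" "\<And>x. x \<notin> {a<..<b} \<Longrightarrow> \<phi> x = 0"
    "\<And>x. x \<notin> {a<..<b} \<Longrightarrow> deriv \<phi> x = 0"
    using test_functions_support[OF assms(2)] by blast
  note \<phi> = test_functionsD[OF assms(2)]
  have cont: "continuous_on {a..b} \<phi>"
    by (rule test_functions_continuous[OF assms(2)])
  have ai: "(\<lambda>x. \<phi> x * k x) absolutely_integrable_on {a..b}"
    by (intro absolutely_integrable_continuous_mult primitive_ofD[OF assms(1)] ab cont)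
  have ai': "(\<lambda>x. H x * deriv \<phi> x) absolutely_integrable_on {a..b}"
    by (intro absolutely_integrable_continuous_real continuous_intros
      primitive_of_continuous_Icc[OF assms(1)] ab \<phi>)
  have "primitive_of (\<lambda>x. k x * \<phi> x + H x * deriv \<phi> x) (\<lambda>x. H x * \<phi> x)"
    by (intro primitive_of_mult assms primitive_of_C1 \<phi>)
  from primitive_ofD(3)[OF this ab(1) less_imp_le[OF ab(2)]]
  have "integral {a..b} (\<lambda>x. k x * \<phi> x + H x * deriv \<phi> x) = 0"
    using ab by simp
  then have "integral {a..b} (\<lambda>x. k x * \<phi> x) + integral {a..b} (\<lambda>x. H x * deriv \<phi> x) = 0"
    using ai ai' by (subst (asm) integral_add) (auto simp: absolutely_integrable_on_def mult.commute)
  moreover have "(LINT x|lebesgue_on {0<..}. k x * \<phi> x) = integral {a..b} (\<lambda>x. k x * \<phi> x)"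
    using ab ai by (intro integral_lebesgue_on_pos_eq) (auto simp: mult.commute)
  moreover have "(LINT x|lebesgue_on {0<..}. H x * deriv \<phi> x) = integral {a..b} (\<lambda>x. H x * deriv \<phi> x)"
    using ab ai' by (intro integral_lebesgue_on_pos_eq) auto
  ultimately show ?thesis by simp
qed

lemma has_weak_deriv_primitive:
  assumes "primitive_of k H" "k \<in> borel_measurable (lebesgue_on {0<..})"
  shows "has_weak_deriv H k {0<..}"
proof -
  have "H \<in> borel_measurable (lebesgue_on {0<..})"
    using primitive_of_continuous[OF assms(1)] by (intro continuous_imp_measurable_on_sets_lebesgue) auto
  then show ?thesis
    unfolding has_weak_deriv_def locally_L1_iff
    using assms primitive_of_weak_deriv[OF assms(1)]
    by (auto intro: absolutely_integrable_continuous_real primitive_of_continuous_Icc primitive_ofD)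
qed

section \<open>Functions that vanish almost everywhere because their integrals vanish\<close>

lemma AE_lebesgue_on_pos:
  fixes P :: "real \<Rightarrow> bool"
  assumes "\<And>a b. 0 < a \<Longrightarrow> a < b \<Longrightarrow> AE x in lebesgue. x \<in> {a<..<b} \<longrightarrow> P x"
  shows "AE x in lebesgue_on {0<..}. P x"
proof -
  \<comment> \<open>A countable exhaustion of the half-line; the shift by 2 makes the left end
    smaller than the right end already for n = 0.\<close>
  have "AE x in lebesgue. \<forall>n. x \<in> {1 / real (n + 2)<..<real (n + 2)} \<longrightarrow> P x"
    unfolding AE_all_countable
    by (intro allI assms) (auto simp: field_simps intro: add_pos_nonneg)
  then have "AE x in lebesgue. 0 < x \<longrightarrow> P x"
  proof eventually_elim
    case (elim x)
    show ?case
    proof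
      assume x: "0 < x"
      obtain n where n: "max x (1 / x) < real n" using reals_Archimedean2 by blast
      then have "1 / real (n + 2) < x" "x < real (n + 2)"
        using x by (auto simp: field_simps)
      then show "P x" using elim by auto
    qed
  qed
  then show ?thesis
    by (subst AE_restrict_space_iff) auto
qed

text \<open>Lebesgue differentiation: off a null set the averages over [x, x + h] approach the value
  at x, and here all these averages are 0. The truncation \<open>v\<close> supplies integrability
  over every interval, whereas \<open>u\<close> is controlled only away from 0.\<close>

lemma AE_zero_if_integrals_zero:
  fixes u :: "real \<Rightarrow> real"
  assumes "\<And>a b. 0 < a \<Longrightarrow> a < b \<Longrightarrow> u integrable_on {a..b} \<and> integral {a..b} u = 0"
  shows "AE x in lebesgue_on {0<..}. u x = 0"
proof (rule AE_lebesgue_on_pos)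
  fix a b :: real assume ab: "0 < a" "a < b"
  define v where "v = (\<lambda>x. if x \<in> {a..b} then u x else 0)"
  have "v integrable_on UNIV"
    unfolding v_def integrable_restrict_UNIV using assms[OF ab] by simp
  then have "v integrable_on cbox c d" for c d
    using integrable_on_subcbox by blast
  then obtain N where N: "negligible N"
    and k: "\<And>x e. \<lbrakk>x \<notin> N; 0 < e\<rbrakk> \<Longrightarrow> \<exists>d>0. \<forall>h. 0 < h \<and> h < d \<longrightarrow>
                  norm (integral (cbox x (x + h *\<^sub>R One)) v /\<^sub>R h ^ DIM(real) - v x) < e"
    using integrable_ccontinuous_explicit by blast
  have "u x = 0" if x: "x \<in> {a<..<b}" "x \<notin> N" for x
  proof (rule ccontr)
    assume "u x \<noteq> 0"
    then obtain d where d: "d > 0"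
      "\<And>h. 0 < h \<Longrightarrow> h < d \<Longrightarrow> norm (integral (cbox x (x + h *\<^sub>R One)) v /\<^sub>R h ^ DIM(real) - v x) < \<bar>u x\<bar>"
      using k[OF x(2), of "\<bar>u x\<bar>"] by auto
    define h where "h = min (d / 2) (b - x)"
    have h: "0 < h" "h < d" "x + h \<le> b"
      using d(1) x by (auto simp: h_def)
    have "integral {x..x + h} v = integral {x..x + h} u"
      using x h by (intro Henstock_Kurzweil_Integration.integral_cong) (auto simp: v_def)
    also have "\<dots> = 0" using assms x h ab by auto
    finally show False
      using d(2)[OF h(1,2)] x by (simp add: v_def)
  qed
  moreover have "AE x in lebesgue. x \<notin> N"
    using N by (intro AE_not_in) (simp add: negligible_iff_null_sets)
  ultimately show "AE x in lebesgue. x \<in> {a<..<b} \<longrightarrow> u x = 0"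
    by (auto elim!: eventually_mono)
qed

text \<open>The fundamental lemma of the calculus of variations. Testing with
  \<open>bump a b n\<close> and letting n grow gives, by dominated convergence, that the integral
  over [a, b] is 0.\<close>

lemma AE_zero_if_test_integrals_zero:
  assumes u: "\<And>a b. 0 < a \<Longrightarrow> u absolutely_integrable_on {a..b}"
    and z: "\<And>\<phi>. \<phi> \<in> test_functions {0<..} \<Longrightarrow> (LINT x|lebesgue_on {0<..}. u x * \<phi> x) = 0"
  shows "AE x in lebesgue_on {0<..}. u x = 0"
proof (rule AE_zero_if_integrals_zero)
  fix a b :: real assume ab: "0 < a" "a < b"
  have ai: "(\<lambda>x. u x * bump a b n x) absolutely_integrable_on {a..b}" for n
  proof -
    have "continuous_on {a..b} (bump a b n)"
      by (intro test_functions_continuous bump_test_function ab)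
    then show ?thesis
      using absolutely_integrable_continuous_mult[OF _ u[OF ab(1)], of b "bump a b n"]
      by (simp add: mult.commute)
  qed
  have "integral {a..b} (\<lambda>x. u x * bump a b n x) = 0" for n
    using z[OF bump_test_function[OF ab(1)], of b n]
    by (subst (asm) integral_lebesgue_on_pos_eq[OF ab(1) ai]) (auto simp: bump_outside)
  moreover have "(\<lambda>n. integral {a..b} (\<lambda>x. u x * bump a b n x))
      \<longlonglongrightarrow> integral {a..b} (\<lambda>x. if x \<in> {a<..<b} then u x else 0)"
  proof (rule dominated_convergence)
    show "(\<lambda>x. u x * bump a b n x) integrable_on {a..b}" for n
      using ai by (simp add: absolutely_integrable_on_def)
    show "(\<lambda>x. \<bar>u x\<bar>) integrable_on {a..b}"
      using u[OF ab(1)] by (simp add: absolutely_integrable_on_def)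
    show "norm (u x * bump a b n x) \<le> \<bar>u x\<bar>" for n x
      using bump_bound[of a b n x] by (auto simp: abs_mult intro!: mult_left_le)
    show "(\<lambda>n. u x * bump a b n x) \<longlonglongrightarrow> (if x \<in> {a<..<b} then u x else 0)" for x
      using tendsto_mult[OF tendsto_const bump_tendsto, of x a b "u x"] by (auto simp: bump_outside)
  qed
  ultimately have "integral {a..b} (\<lambda>x. if x \<in> {a<..<b} then u x else 0) = 0"
    by (simp add: LIMSEQ_const_iff)
  moreover have "integral {a..b} (\<lambda>x. if x \<in> {a<..<b} then u x else 0) = integral {a..b} u"
    by (rule integral_spike[of "{a, b}"]) auto
  ultimately show "u integrable_on {a..b} \<and> integral {a..b} u = 0"
    using u[OF ab(1), of b] by (simp add: absolutely_integrable_on_def)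
qed

text \<open>The antiderivative that is 0 at a is constant on each side of [a, b]. The zero integral
  makes it 0 at b too, so it keeps its support in [a, b].\<close>

lemma test_function_antiderivative:
  assumes \<eta>: "\<And>n. n_diff n \<eta>" and ab: "0 < a" "a \<le> b" and z: "\<And>x. x \<notin> {a..b} \<Longrightarrow> \<eta> x = 0"
    and int: "integral {a..b} \<eta> = 0"
  obtains \<xi> where "\<xi> \<in> test_functions {0<..}" "deriv \<xi> = \<eta>"
proof -
  have "isCont \<eta> x" for x
    using \<eta>[of 1] by (auto intro: differentiable_imp_continuous_within)
  then obtain X where X: "\<And>x. (X has_vector_derivative \<eta> x) (at x)"
    using einterval_antiderivative[of "-\<infinity>" "\<infinity>" \<eta>] by auto
  define \<xi> where "\<xi> x = X x - X a" for x
  have D: "(\<xi> has_real_derivative \<eta> x) (at x)" for x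
    unfolding \<xi>_def using X[of x]
    by (auto intro!: derivative_eq_intros simp: has_real_derivative_iff_has_vector_derivative)
  have "\<xi> a = 0" by (simp add: \<xi>_def)
  have "(\<eta> has_integral (\<xi> b - \<xi> a)) {a..b}"
    using D ab by (intro fundamental_theorem_of_calculus)
      (auto intro: has_field_derivative_at_within simp flip: has_real_derivative_iff_has_vector_derivative)
  then have "\<xi> b = 0" using int \<open>\<xi> a = 0\<close> by (simp add: integral_unique)
  have "\<xi> x = 0" if "x \<notin> {a..b}" for x
  proof (cases "x < a")
    case True
    have "\<exists>y. x < y \<and> y < a \<and> \<xi> a - \<xi> x = (a - x) * \<eta> y"
      by (rule MVT2) (use True D in auto)
    then show ?thesis using z \<open>\<xi> a = 0\<close> by auto
  next
    case False
    then have "b < x" using that by auto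
    then have "\<exists>y. b < y \<and> y < x \<and> \<xi> x - \<xi> b = (x - b) * \<eta> y"
      by (intro MVT2) (use D in auto)
    then show ?thesis using z \<open>\<xi> b = 0\<close> by auto
  qed
  moreover have "n_diff n \<xi>" for n
    by (cases n) (auto intro: n_diff_SucI[OF D \<eta>] simp del: n_diff.simps(2))
  ultimately have "\<xi> \<in> test_functions {0<..}"
    using ab by (intro test_functionsI[of _ a b]) auto
  moreover have "deriv \<xi> = \<eta>"
    using D by (auto intro!: DERIV_imp_deriv)
  ultimately show ?thesis ..
qed

text \<open>A test function minus its integral times a fixed normalised bump is the derivative of a
  test function.\<close>

lemma du_Bois_Reymond:
  assumes u: "\<And>a b. 0 < a \<Longrightarrow> u absolutely_integrable_on {a..b}"
    and z: "\<And>\<phi>. \<phi> \<in> test_functions {0<..} \<Longrightarrow> (LINT x|lebesgue_on {0<..}. u x * deriv \<phi> x) = 0"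
  obtains c where "AE x in lebesgue_on {0<..}. u x = c"
proof -
  define I :: "(real \<Rightarrow> real) \<Rightarrow> real" where "I F = (LINT x|lebesgue_on {0<..}. F x)" for F
  define \<psi> where "\<psi> = bump 1 2 0"
  have \<psi>: "\<psi> \<in> test_functions {0<..}"
    unfolding \<psi>_def by (rule bump_test_function) simp
  have int: "integrable (lebesgue_on {0<..}) \<phi>" "integrable (lebesgue_on {0<..}) (\<lambda>x. u x * \<phi> x)"
    if \<phi>: "\<phi> \<in> test_functions {0<..}" for \<phi>
    using integrable_mult_test_function(1)[of "\<lambda>_. 1", OF _ \<phi>] integrable_mult_test_function(1)[OF u \<phi>]
    by (simp_all add: absolutely_integrable_continuous_real)
  have "I \<psi> \<noteq> 0"
  proof
    assume "I \<psi> = 0"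
    have "AE x in lebesgue_on {0<..}. \<psi> x = 0"
      using \<open>I \<psi> = 0\<close> int(1)[OF \<psi>] bump_pos[of _ 1 2 0] bump_outside[of _ 1 2 0]
      unfolding I_def \<psi>_def
      by (subst (asm) integral_nonneg_eq_0_iff_AE) (auto intro!: AE_I2 less_imp_le simp: order_le_less)
    then have "AE x in lebesgue. 0 < x \<longrightarrow> \<psi> x = 0"
      by (subst (asm) AE_restrict_space_iff) auto
    then have "AE x in lebesgue. x \<notin> {1<..<(2::real)}"
    proof eventually_elim
      case (elim x)
      then show ?case
        using bump_pos[of x 1 2 0] by (auto simp: \<psi>_def)
    qed
    then have "emeasure lebesgue {1<..<(2::real)} = 0"
      by (subst (asm) AE_iff_measurable[of "{1<..<(2::real)}"]) auto
    then show False by simp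
  qed
  \<comment> \<open>The only possible constant: the value found by testing u = c against
    \<open>\<psi>\<close>.\<close>
  define c where "c = I (\<lambda>x. u x * \<psi> x) / I \<psi>"
  have "AE x in lebesgue_on {0<..}. u x - c = 0"
  proof (rule AE_zero_if_test_integrals_zero)
    show "(\<lambda>x. u x - c) absolutely_integrable_on {a..b}" if "0 < a" for a b
      using u[OF that] by (intro set_integral_diff) (auto intro: absolutely_integrable_continuous_real)
    fix \<phi> assume \<phi>: "\<phi> \<in> test_functions {0<..}"
    define \<eta> where "\<eta> x = \<phi> x + (- I \<phi> / I \<psi>) * \<psi> x" for x
    obtain a b where ab: "0 < a" "a < b" "\<And>x. x \<notin> {a<..<b} \<Longrightarrow> \<phi> x = 0"
      using test_functions_support[OF \<phi>] by metis
    have out: "\<eta> x = 0" if "x \<notin> {min 1 a..max 2 b}" for x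
    proof -
      have "x \<notin> {a<..<b}" "x \<notin> {1<..<2}"
        using that by auto
      then show ?thesis
        using ab(3) bump_outside by (simp add: \<eta>_def \<psi>_def)
    qed
    have sm: "n_diff n \<eta>" for n
      unfolding \<eta>_def
      by (intro n_diff_add n_diff_mult n_diff_const test_functionsD(1) \<phi> \<psi>)
    have "I \<eta> = I \<phi> + (- I \<phi> / I \<psi>) * I \<psi>"
      unfolding I_def \<eta>_def using int(1)[OF \<phi>] int(1)[OF \<psi>] by (subst Bochner_Integration.integral_add) auto
    then have "I \<eta> = 0" using \<open>I \<psi> \<noteq> 0\<close> by simp
    moreover have "I \<eta> = integral {min 1 a..max 2 b} \<eta>"
      unfolding I_def
    proof (rule integral_lebesgue_on_pos_eq(2)[OF _ _ out])
      show "\<eta> absolutely_integrable_on {min 1 a..max 2 b}"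
        unfolding \<eta>_def
        by (intro absolutely_integrable_continuous_real continuous_intros test_functions_continuous \<phi> \<psi>)
    qed (use ab in auto)
    ultimately have zero: "integral {min 1 a..max 2 b} \<eta> = 0" by simp
    obtain \<xi> where \<xi>: "\<xi> \<in> test_functions {0<..}" "deriv \<xi> = \<eta>"
      by (rule test_function_antiderivative[OF sm _ _ out zero]) (use ab in auto)
    have "0 = I (\<lambda>x. u x * \<eta> x)"
      using z[OF \<xi>(1)] \<xi>(2) by (simp add: I_def)
    also have "\<dots> = I (\<lambda>x. u x * \<phi> x + (- I \<phi> / I \<psi>) * (u x * \<psi> x))"
      by (simp add: \<eta>_def algebra_simps)
    also have "\<dots> = I (\<lambda>x. u x * \<phi> x) + (- I \<phi> / I \<psi>) * I (\<lambda>x. u x * \<psi> x)"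
      unfolding I_def using int(2)[OF \<phi>] int(2)[OF \<psi>] by (subst Bochner_Integration.integral_add) auto
    finally have "I (\<lambda>x. u x * \<phi> x) - c * I \<phi> = 0"
      by (simp add: c_def)
    moreover have "I (\<lambda>x. (u x - c) * \<phi> x) = I (\<lambda>x. u x * \<phi> x) - c * I \<phi>"
      unfolding I_def left_diff_distrib using int[OF \<phi>]
      by (subst Bochner_Integration.integral_diff) auto
    ultimately show "(LINT x|lebesgue_on {0<..}. (u x - c) * \<phi> x) = 0"
      by (simp add: I_def)
  qed
  then show ?thesis
    using that[of c] by simp
qed

lemma has_weak_deriv_imp_primitive:
  assumes "has_weak_deriv f g {0<..}"
  obtains F where "primitive_of g F" "AE x in lebesgue_on {0<..}. f x = F x"
proof -
  have f: "f \<in> borel_measurable (lebesgue_on {0<..})" "\<And>a b. 0 < a \<Longrightarrow> f absolutely_integrable_on {a..b}"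
    and g: "g \<in> borel_measurable (lebesgue_on {0<..})" "\<And>a b. 0 < a \<Longrightarrow> g absolutely_integrable_on {a..b}"
    using assms by (auto simp: has_weak_deriv_def locally_L1_iff)
  \<comment> \<open>The base point is 1 and not 0, since \<open>g\<close> need not be integrable
    near 0; hence the minus sign for x < 1.\<close>
  define F where "F x = (if 1 \<le> x then integral {1..x} g else - integral {x..1} g)" for x
  have int: "g integrable_on {a..b}" if "0 < a" for a b
    using g(2)[OF that] by (simp add: absolutely_integrable_on_def)
  have F: "primitive_of g F"
    unfolding primitive_of_def
  proof (intro allI impI conjI g)
    fix a b :: real assume ab: "0 < a" "a \<le> b"
    note comb = Henstock_Kurzweil_Integration.integral_combine[of _ _ _ g, OF _ _ int]
    consider "1 \<le> a" | "a < 1" "1 \<le> b" | "b < 1" by linarith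
    then show "integral {a..b} g = F b - F a"
    proof cases
      case 1
      then show ?thesis using ab comb[of 1 a b] by (simp add: F_def)
    next
      case 2
      then show ?thesis using ab comb[of a 1 b] by (simp add: F_def)
    next
      case 3
      then show ?thesis using ab comb[of a b 1] by (simp add: F_def)
    qed
  qed
  have Fai: "F absolutely_integrable_on {a..b}" if "0 < a" for a b
    by (intro absolutely_integrable_continuous_real primitive_of_continuous_Icc[OF F that])
  \<comment> \<open>Both \<open>f\<close> and \<open>F\<close> have weak derivative
    \<open>g\<close>, so their difference has weak derivative 0; the resulting constant is then
    absorbed into the primitive.\<close>
  have "\<exists>c. AE x in lebesgue_on {0<..}. f x - F x = c"
  proof (rule du_Bois_Reymond[of "\<lambda>x. f x - F x"])
    show "(\<lambda>x. f x - F x) absolutely_integrable_on {a..b}" if "0 < a" for a b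
      by (intro set_integral_diff f Fai that)
    fix \<phi> assume \<phi>: "\<phi> \<in> test_functions {0<..}"
    have "(LINT x|lebesgue_on {0<..}. (f x - F x) * deriv \<phi> x) =
        (LINT x|lebesgue_on {0<..}. f x * deriv \<phi> x) - (LINT x|lebesgue_on {0<..}. F x * deriv \<phi> x)"
      unfolding left_diff_distrib
      by (intro Bochner_Integration.integral_diff integrable_mult_test_function(2) f Fai \<phi>)
    also have "\<dots> = 0"
      using primitive_of_weak_deriv[OF F \<phi>] assms \<phi> by (simp add: has_weak_deriv_def)
    finally show "(LINT x|lebesgue_on {0<..}. (f x - F x) * deriv \<phi> x) = 0" .
  qed blast
  then obtain c where c: "AE x in lebesgue_on {0<..}. f x - F x = c" by blast
  show ?thesis
  proof
    show "primitive_of g (\<lambda>x. F x + c)"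
      using F by (simp add: primitive_of_def)
    show "AE x in lebesgue_on {0<..}. f x = F x + c"
      using c by eventually_elim simp
  qed
qed

text \<open>This removes the arbitrary choice in \<open>weak_deriv\<close>: any known weak
  derivative may be used to compute the energy.\<close>

lemma weak_deriv_unique:
  assumes "has_weak_deriv f g {0<..}" "has_weak_deriv f h {0<..}"
  shows "AE x in lebesgue_on {0<..}. g x = h x"
proof -
  have g: "\<And>a b. 0 < a \<Longrightarrow> g absolutely_integrable_on {a..b}"
    and h: "\<And>a b. 0 < a \<Longrightarrow> h absolutely_integrable_on {a..b}"
    using assms by (auto simp: has_weak_deriv_def locally_L1_iff)
  have "AE x in lebesgue_on {0<..}. g x - h x = 0"
  proof (rule AE_zero_if_test_integrals_zero)
    show "(\<lambda>x. g x - h x) absolutely_integrable_on {a..b}" if "0 < a" for a b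
      by (intro set_integral_diff g h that)
    fix \<phi> assume \<phi>: "\<phi> \<in> test_functions {0<..}"
    have "(LINT x|lebesgue_on {0<..}. (g x - h x) * \<phi> x) =
        (LINT x|lebesgue_on {0<..}. g x * \<phi> x) - (LINT x|lebesgue_on {0<..}. h x * \<phi> x)"
      unfolding left_diff_distrib
      by (intro Bochner_Integration.integral_diff integrable_mult_test_function(1) g h \<phi>)
    also have "\<dots> = 0"
      using assms \<phi> by (auto simp: has_weak_deriv_def)
    finally show "(LINT x|lebesgue_on {0<..}. (g x - h x) * \<phi> x) = 0" .
  qed
  then show ?thesis by simp
qed

section \<open>Convexity of the energy along quadratic means\<close>

text \<open>A majorant independent of \<open>e\<close>, for dominated convergence as
  \<open>e\<close> tends to 0. It rests on \<open>F\<close> and \<open>G\<close> being at most twice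
  the root in absolute value; a vanishing root is harmless, as division by 0 gives 0.\<close>

lemma quadratic_mean_deriv_bound:
  fixes F G k l e :: real
  assumes "e \<ge> 0"
  shows "\<bar>(F * k + G * l) / (2 * sqrt ((F\<^sup>2 + G\<^sup>2) / 2 + e))\<bar> \<le> \<bar>k\<bar> + \<bar>l\<bar>"
proof -
  define s where "s = sqrt ((F\<^sup>2 + G\<^sup>2) / 2 + e)"
  have s: "s \<ge> 0" "s\<^sup>2 = (F\<^sup>2 + G\<^sup>2) / 2 + e"
    using assms by (auto simp: s_def)
  have "F\<^sup>2 \<le> 4 * s\<^sup>2" "G\<^sup>2 \<le> 4 * s\<^sup>2"
    using assms zero_le_power2[of F] zero_le_power2[of G] unfolding s(2) by argo+
  then have "\<bar>F\<bar> \<le> \<bar>2 * s\<bar>" "\<bar>G\<bar> \<le> \<bar>2 * s\<bar>"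
    unfolding abs_le_square_iff by (simp_all add: power_mult_distrib)
  then have "\<bar>F\<bar> \<le> 2 * s" "\<bar>G\<bar> \<le> 2 * s"
    using s(1) by simp_all
  then have "\<bar>F\<bar> * \<bar>k\<bar> + \<bar>G\<bar> * \<bar>l\<bar> \<le> 2 * s * \<bar>k\<bar> + 2 * s * \<bar>l\<bar>"
    by (intro add_mono mult_right_mono) auto
  moreover have "\<bar>F * k + G * l\<bar> \<le> \<bar>F\<bar> * \<bar>k\<bar> + \<bar>G\<bar> * \<bar>l\<bar>"
    by (metis abs_mult abs_triangle_ineq)
  ultimately have "\<bar>F * k + G * l\<bar> \<le> 2 * s * (\<bar>k\<bar> + \<bar>l\<bar>)"
    by (simp add: distrib_left)
  then show ?thesis
    using s(1) unfolding s_def[symmetric]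
    by (cases "s = 0") (simp_all add: abs_mult divide_le_eq mult.commute)
qed

text \<open>The formal derivative of the quadratic mean. At a common zero of \<open>F\<close> and
  \<open>G\<close> the quotient is 0/0, that is 0, and this is the value that the limit of the
  regularised derivatives requires.\<close>

definition quadratic_mean_deriv ::
    "(real \<Rightarrow> real) \<Rightarrow> (real \<Rightarrow> real) \<Rightarrow> (real \<Rightarrow> real) \<Rightarrow> (real \<Rightarrow> real) \<Rightarrow> real \<Rightarrow> real" where
  "quadratic_mean_deriv F k G l x = (F x * k x + G x * l x) / (2 * sqrt (((F x)\<^sup>2 + (G x)\<^sup>2) / 2))"

lemma primitive_of_quadratic_mean:
  assumes F: "primitive_of k F" and G: "primitive_of l G"
  shows "primitive_of (quadratic_mean_deriv F k G l) (\<lambda>x. sqrt (((F x)\<^sup>2 + (G x)\<^sup>2) / 2))"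
proof -
  define W where "W x = ((F x)\<^sup>2 + (G x)\<^sup>2) / 2" for x
  define w where "w x = F x * k x + G x * l x" for x
  define e :: "nat \<Rightarrow> real" where "e n = inverse (real (Suc n))" for n
  have e: "e n > 0" for n by (simp add: e_def)
  have "primitive_of (\<lambda>x. 1/2 * (2 * F x * k x) + 1/2 * (2 * G x * l x)) (\<lambda>x. 1/2 * (F x)\<^sup>2 + 1/2 * (G x)\<^sup>2)"
    by (intro primitive_of_add primitive_of_cmult primitive_of_power2 F G)
  then have W: "primitive_of w W"
    by (simp add: w_def[abs_def] W_def[abs_def] add_divide_distrib)
  have W0: "W x \<ge> 0" for x by (simp add: W_def)
  have approx: "primitive_of (\<lambda>x. inverse (2 * sqrt (W x + e n)) * w x) (\<lambda>x. sqrt (W x + e n))" for n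
  proof (rule primitive_of_chain[OF W, where T = "{0..}" and \<Phi> = "\<lambda>y. sqrt (y + e n)"
        and \<Phi>' = "\<lambda>y. inverse (2 * sqrt (y + e n))"])
    show "((\<lambda>y. sqrt (y + e n)) has_real_derivative inverse (2 * sqrt (y + e n))) (at y)"
      if "y \<in> {0..}" for y
      using that e[of n] by (auto intro!: derivative_eq_intros simp: divide_simps)
    show "continuous_on {0..} (\<lambda>y. inverse (2 * sqrt (y + e n)))"
      using e[of n] by (intro continuous_intros) (auto simp: add_nonneg_pos less_imp_neq[symmetric])
  qed (auto simp: W0 is_interval_ci)
  have q: "quadratic_mean_deriv F k G l x = inverse (2 * sqrt (W x)) * w x" for x
    unfolding quadratic_mean_deriv_def W_def w_def divide_inverse by (rule mult.commute)
  \<comment> \<open>At a common zero the factor \<open>w x\<close> is 0, so every approximant is 0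
    there, although the other factor blows up.\<close>
  have conv: "(\<lambda>n. inverse (2 * sqrt (W x + e n)) * w x) \<longlonglongrightarrow> quadratic_mean_deriv F k G l x" for x
  proof (cases "W x = 0")
    case True
    then have "F x = 0" "G x = 0"
      by (auto simp: W_def sum_power2_eq_zero_iff)
    then show ?thesis
      by (simp add: q w_def)
  next
    case False
    have "(\<lambda>n. inverse (2 * sqrt (W x + e n)) * w x) \<longlonglongrightarrow> inverse (2 * sqrt (W x + 0)) * w x"
      unfolding e_def using False by (intro tendsto_intros LIMSEQ_inverse_real_of_nat) auto
    then show ?thesis
      by (simp add: q)
  qed
  have bound: "norm (inverse (2 * sqrt (W x + c)) * w x) \<le> \<bar>k x\<bar> + \<bar>l x\<bar>" if "c \<ge> 0" for c x
  proof -
    have "inverse (2 * sqrt (W x + c)) * w x = w x / (2 * sqrt (W x + c))"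
      by (simp only: divide_inverse mult.commute)
    then show ?thesis
      using quadratic_mean_deriv_bound[OF that, of "F x" "k x" "G x" "l x"]
      by (simp only: W_def w_def real_norm_def)
  qed
  show ?thesis
    unfolding primitive_of_def
  proof (intro allI impI conjI)
    fix a b :: real assume ab: "0 < a" "a \<le> b"
    note app = primitive_ofD[OF approx ab(1)]
    have kl: "(\<lambda>x. \<bar>k x\<bar> + \<bar>l x\<bar>) integrable_on {a..b}"
      using primitive_ofD(1)[OF F ab(1)] primitive_ofD(1)[OF G ab(1)]
      by (intro integrable_add) (auto simp: absolutely_integrable_on_def)
    show "quadratic_mean_deriv F k G l absolutely_integrable_on {a..b}"
      by (rule dominated_convergence_absolutely_integrable[OF app(1) kl _ conv])
        (use bound[of 0] in \<open>simp add: q\<close>)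
    have "(\<lambda>n. integral {a..b} (\<lambda>x. inverse (2 * sqrt (W x + e n)) * w x))
        \<longlonglongrightarrow> integral {a..b} (quadratic_mean_deriv F k G l)"
      by (rule dominated_convergence(2)[OF app(2) kl bound conv]) (simp add: less_imp_le[OF e])
    then have "(\<lambda>n. sqrt (W b + e n) - sqrt (W a + e n)) \<longlonglongrightarrow> integral {a..b} (quadratic_mean_deriv F k G l)"
      unfolding app(3)[OF ab(2)] .
    moreover have "(\<lambda>n. sqrt (W b + e n) - sqrt (W a + e n)) \<longlonglongrightarrow> sqrt (W b + 0) - sqrt (W a + 0)"
      unfolding e_def by (intro tendsto_intros LIMSEQ_inverse_real_of_nat)
    ultimately have "integral {a..b} (quadratic_mean_deriv F k G l) = sqrt (W b + 0) - sqrt (W a + 0)"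
      by (rule LIMSEQ_unique)
    then show "integral {a..b} (quadratic_mean_deriv F k G l) =
        sqrt (((F b)\<^sup>2 + (G b)\<^sup>2) / 2) - sqrt (((F a)\<^sup>2 + (G a)\<^sup>2) / 2)"
      by (simp add: W_def)
  qed
qed

lemma quadratic_mean_deriv_sq_le:
  "(quadratic_mean_deriv F k G l x)\<^sup>2 \<le> ((k x)\<^sup>2 + (l x)\<^sup>2) / 2"
proof -
  define s where "s = (F x)\<^sup>2 + (G x)\<^sup>2"
  have s: "s \<ge> 0" by (simp add: s_def)
  \<comment> \<open>Lagrange's identity; dropping the second square leaves Cauchy-Schwarz.\<close>
  have "(F x * k x + G x * l x)\<^sup>2 + (F x * l x - G x * k x)\<^sup>2 = s * ((k x)\<^sup>2 + (l x)\<^sup>2)"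
    by (simp add: s_def power2_eq_square algebra_simps)
  then have cs: "(F x * k x + G x * l x)\<^sup>2 \<le> s * ((k x)\<^sup>2 + (l x)\<^sup>2)"
    by (metis le_add_same_cancel1 zero_le_power2)
  have "(quadratic_mean_deriv F k G l x)\<^sup>2 = (F x * k x + G x * l x)\<^sup>2 / (2 * s)"
    using s by (simp add: quadratic_mean_deriv_def power_divide power_mult_distrib flip: s_def)
  also have "\<dots> \<le> ((k x)\<^sup>2 + (l x)\<^sup>2) / 2"
    using cs s by (cases "s = 0") (simp_all add: divide_le_eq algebra_simps)
  finally show ?thesis .
qed

text \<open>For positive arguments this is midpoint convexity; if one argument is 0 it reduces to
  (1/2)^q \<le> 1/2.\<close>

lemma powr_midpoint_le:
  fixes a b q :: real
  assumes "a \<ge> 0" "b \<ge> 0" "q \<ge> 1"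
  shows "((a + b) / 2) powr q \<le> (a powr q + b powr q) / 2"
proof -
  have half: "(c / 2) powr q \<le> c powr q / 2" if "c \<ge> 0" for c :: real
  proof -
    have "(1 / 2) powr q \<le> (1 / 2 :: real) powr 1"
      using assms(3) by (intro powr_mono') auto
    then have "c powr q * (1 / 2) powr q \<le> c powr q * (1 / 2)"
      by (intro mult_left_mono) auto
    then show ?thesis
      using that by (simp add: powr_divide)
  qed
  consider "a = 0" | "b = 0" | "a > 0" "b > 0" using assms by linarith
  then show ?thesis
  proof cases
    case 3
    from convex_onD[OF powr_convex[OF assms(3)], of "1/2" a b] 3 show ?thesis
      by (simp add: field_simps)
  qed (use half assms in auto)
qed

text \<open>The functional \<open>I_p\<close> with the derivative as a separate argument, so that no
  choice of representative is involved.\<close>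

definition energy :: "real \<Rightarrow> (real \<Rightarrow> real) \<Rightarrow> (real \<Rightarrow> real) \<Rightarrow> ennreal" where
  "energy p k H = (\<integral>\<^sup>+ r. ennreal
     ((((k r)\<^sup>2 + (H r)\<^sup>2 / r\<^sup>2) powr (p / 2) + 1 / 2 * (1 - (H r)\<^sup>2)\<^sup>2) * r) \<partial>lebesgue_on {0<..})"

lemma energy_cong_AE:
  assumes "AE x in lebesgue_on {0<..}. k x = k' x" "AE x in lebesgue_on {0<..}. H x = H' x"
  shows "energy p k H = energy p k' H'"
  unfolding energy_def
  by (rule nn_integral_cong_AE) (use assms in eventually_elim, simp)

section \<open>Passing between \<open>I_p\<close> on \<open>X_p\<close> and the energy of explicit
  pairs\<close>

lemma I_p_eq_energy: "I_p p f = energy p (weak_deriv {0<..} f) f"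
  by (simp add: I_p_def energy_def)

lemma has_weak_deriv_weak_deriv:
  "has_weak_deriv f g S \<Longrightarrow> has_weak_deriv f (weak_deriv S f) S"
  unfolding weak_deriv_def by (rule someI[where P = "\<lambda>g. has_weak_deriv f g S"])

lemma X_p_primitive:
  assumes "f \<in> X_p p"
  obtains k F where "primitive_of k F" "AE x in lebesgue_on {0<..}. f x = F x"
    "k \<in> locally_Lp p {0<..}" "I_p p f = energy p k F"
proof -
  obtain k where k: "k \<in> locally_Lp p {0<..}" "has_weak_deriv f k {0<..}"
    using assms by (auto simp: X_p_def W1p_loc_def)
  obtain F where F: "primitive_of k F" "AE x in lebesgue_on {0<..}. f x = F x"
    using has_weak_deriv_imp_primitive[OF k(2)] .
  have "I_p p f = energy p k F"
    unfolding I_p_eq_energy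
    by (intro energy_cong_AE weak_deriv_unique[OF has_weak_deriv_weak_deriv[OF k(2)] k(2)] F)
  with k F that show ?thesis by blast
qed

text \<open>The way back into \<open>X_p\<close>: continuity makes \<open>H\<close> locally
  p-integrable, and the integral in the definition of \<open>X_p\<close> is at most the energy
  because the potential is non-negative.\<close>

lemma primitive_in_X_p:
  assumes "p > 0" and H: "primitive_of k H" and k: "k \<in> locally_Lp p {0<..}"
    and fin: "energy p k H < \<infinity>"
  shows "H \<in> X_p p" "I_p p H = energy p k H"
proof -
  have wd: "has_weak_deriv H k {0<..}"
    using has_weak_deriv_primitive[OF H] k by (simp add: locally_Lp_def)
  have "(\<lambda>x. \<bar>H x\<bar> powr p) absolutely_integrable_on {a..b}" if "0 < a" for a b
    using \<open>p > 0\<close>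
    by (intro absolutely_integrable_continuous_real continuous_on_powr' continuous_intros
        primitive_of_continuous_Icc[OF H that]) auto
  then have "H \<in> locally_Lp p {0<..}"
    using wd by (auto simp: locally_Lp_iff has_weak_deriv_def locally_L1_iff)
  then have W1p: "H \<in> W1p_loc p {0<..}"
    using k wd by (auto simp: W1p_loc_def)
  show eq: "I_p p H = energy p k H"
    unfolding I_p_eq_energy
    by (intro energy_cong_AE weak_deriv_unique[OF has_weak_deriv_weak_deriv[OF wd] wd]) auto
  have "(\<integral>\<^sup>+ r. ennreal ((\<bar>weak_deriv {0<..} H r\<bar>\<^sup>2 + (H r)\<^sup>2 / r\<^sup>2) powr (p / 2) * r)
        \<partial>lebesgue_on {0<..}) \<le> I_p p H"
    unfolding I_p_def
    by (intro nn_integral_mono ennreal_leI mult_right_mono) auto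
  also have "\<dots> < \<infinity>"
    using fin eq by simp
  finally show "H \<in> X_p p"
    using W1p by (simp add: X_p_def)
qed

lemma quadratic_mean_deriv_locally_Lp:
  assumes "p > 0" "primitive_of k F" "primitive_of l G" "k \<in> locally_Lp p {0<..}" "l \<in> locally_Lp p {0<..}"
  shows "quadratic_mean_deriv F k G l \<in> locally_Lp p {0<..}"
proof -
  let ?q = "quadratic_mean_deriv F k G l"
  have [measurable]: "F \<in> borel_measurable (lebesgue_on {0<..})" "G \<in> borel_measurable (lebesgue_on {0<..})"
    using primitive_of_continuous[OF assms(2)] primitive_of_continuous[OF assms(3)]
    by (auto intro: continuous_imp_measurable_on_sets_lebesgue)
  have [measurable]: "k \<in> borel_measurable (lebesgue_on {0<..})" "l \<in> borel_measurable (lebesgue_on {0<..})"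
    using assms by (auto simp: locally_Lp_def)
  have m: "?q \<in> borel_measurable (lebesgue_on {0<..})"
    unfolding quadratic_mean_deriv_def[abs_def] by measurable
  have "(\<lambda>x. \<bar>?q x\<bar> powr p) absolutely_integrable_on {a..b}" if "0 < a" for a b
  proof (rule measurable_bounded_by_integrable_imp_absolutely_integrable)
    show "(\<lambda>x. \<bar>?q x\<bar> powr p) \<in> borel_measurable (lebesgue_on {a..b})"
      by (rule borel_measurable_subset_lebesgue_on[of _ "{0<..}"]) (use m that in auto)
    show "(\<lambda>x. \<bar>k x\<bar> powr p + \<bar>l x\<bar> powr p) integrable_on {a..b}"
      using assms(4,5) that by (intro integrable_add) (auto simp: locally_Lp_iff absolutely_integrable_on_def)
    show "norm (\<bar>?q x\<bar> powr p) \<le> \<bar>k x\<bar> powr p + \<bar>l x\<bar> powr p" for x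
    proof -
      \<comment> \<open>A mean of two squares is at most the larger one, so the p-th power is
        dominated by one of the two given ones.\<close>
      have "(?q x)\<^sup>2 \<le> max ((k x)\<^sup>2) ((l x)\<^sup>2)"
        using quadratic_mean_deriv_sq_le[of F k G l x] by argo
      then have "\<bar>?q x\<bar> \<le> \<bar>k x\<bar> \<or> \<bar>?q x\<bar> \<le> \<bar>l x\<bar>"
        unfolding abs_le_square_iff le_max_iff_disj .
      then have "\<bar>?q x\<bar> powr p \<le> \<bar>k x\<bar> powr p \<or> \<bar>?q x\<bar> powr p \<le> \<bar>l x\<bar> powr p"
        using \<open>p > 0\<close> by (auto intro: powr_mono2)
      then show ?thesis
        by (auto intro: add_increasing add_increasing2)
    qed
  qed simp
  then show ?thesis
    using m by (simp add: locally_Lp_iff)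
qed

text \<open>Doubling clears the averages, so the gap appears with 1/4 instead of 1/8. It stands as a
  summand on the left so that the integrated inequality needs no subtraction of possibly infinite
  energies.\<close>

lemma density_quadratic_mean_le:
  fixes p r :: real and F G k l :: "real \<Rightarrow> real"
  assumes "p \<ge> 2" "r > 0"
  defines "h \<equiv> \<lambda>x. sqrt (((F x)\<^sup>2 + (G x)\<^sup>2) / 2)"
  shows "2 * ((((quadratic_mean_deriv F k G l r)\<^sup>2 + (h r)\<^sup>2 / r\<^sup>2) powr (p / 2) + 1 / 2 * (1 - (h r)\<^sup>2)\<^sup>2) * r)
      + ((F r)\<^sup>2 - (G r)\<^sup>2)\<^sup>2 / 4 * r
    \<le> (((k r)\<^sup>2 + (F r)\<^sup>2 / r\<^sup>2) powr (p / 2) + 1 / 2 * (1 - (F r)\<^sup>2)\<^sup>2) * r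
      + (((l r)\<^sup>2 + (G r)\<^sup>2 / r\<^sup>2) powr (p / 2) + 1 / 2 * (1 - (G r)\<^sup>2)\<^sup>2) * r"
proof -
  define A where "A = (k r)\<^sup>2 + (F r)\<^sup>2 / r\<^sup>2"
  define B where "B = (l r)\<^sup>2 + (G r)\<^sup>2 / r\<^sup>2"
  define C where "C = (quadratic_mean_deriv F k G l r)\<^sup>2 + (h r)\<^sup>2 / r\<^sup>2"
  have h2: "(h r)\<^sup>2 = ((F r)\<^sup>2 + (G r)\<^sup>2) / 2"
    by (simp add: h_def)
  have "C \<le> ((k r)\<^sup>2 + (l r)\<^sup>2) / 2 + (h r)\<^sup>2 / r\<^sup>2"
    unfolding C_def by (intro add_right_mono quadratic_mean_deriv_sq_le)
  \<comment> \<open>The term \<open>(h r)\<^sup>2 / r\<^sup>2\<close> is linear in the square of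
    \<open>h\<close>, hence averages exactly.\<close>
  also have "\<dots> = (A + B) / 2"
    unfolding A_def B_def h2 by (simp add: add_divide_distrib)
  finally have "C \<le> (A + B) / 2" .
  moreover have "C \<ge> 0" by (simp add: C_def)
  ultimately have "C powr (p / 2) \<le> ((A + B) / 2) powr (p / 2)"
    using assms(1) by (intro powr_mono2) auto
  also have "\<dots> \<le> (A powr (p / 2) + B powr (p / 2)) / 2"
    using assms(1) by (intro powr_midpoint_le) (auto simp: A_def B_def)
  finally have "2 * C powr (p / 2) \<le> A powr (p / 2) + B powr (p / 2)" by simp
  \<comment> \<open>The parallelogram law for 1 - F^2 and 1 - G^2, whose mean is 1 - h^2.\<close>
  moreover have "2 * (1 / 2 * (1 - (h r)\<^sup>2)\<^sup>2) + ((F r)\<^sup>2 - (G r)\<^sup>2)\<^sup>2 / 4 =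
      1 / 2 * (1 - (F r)\<^sup>2)\<^sup>2 + 1 / 2 * (1 - (G r)\<^sup>2)\<^sup>2"
    unfolding h2 by (simp add: power2_eq_square field_simps)
  ultimately have "2 * (C powr (p / 2) + 1 / 2 * (1 - (h r)\<^sup>2)\<^sup>2) + ((F r)\<^sup>2 - (G r)\<^sup>2)\<^sup>2 / 4
      \<le> (A powr (p / 2) + 1 / 2 * (1 - (F r)\<^sup>2)\<^sup>2) + (B powr (p / 2) + 1 / 2 * (1 - (G r)\<^sup>2)\<^sup>2)"
    by argo
  from mult_right_mono[OF this less_imp_le[OF assms(2)]] show ?thesis
    unfolding A_def B_def C_def by (simp only: distrib_right mult.assoc)
qed

lemma energy_quadratic_mean_le:
  fixes p :: real
  assumes "p \<ge> 2" and F: "primitive_of k F" and G: "primitive_of l G"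
    and k: "k \<in> locally_Lp p {0<..}" and l: "l \<in> locally_Lp p {0<..}"
  shows "2 * energy p (quadratic_mean_deriv F k G l) (\<lambda>x. sqrt (((F x)\<^sup>2 + (G x)\<^sup>2) / 2))
      + (\<integral>\<^sup>+ r. ennreal (((F r)\<^sup>2 - (G r)\<^sup>2)\<^sup>2 / 4 * r) \<partial>lebesgue_on {0<..})
    \<le> energy p k F + energy p l G"
proof -
  define q where "q = quadratic_mean_deriv F k G l"
  define h where "h x = sqrt (((F x)\<^sup>2 + (G x)\<^sup>2) / 2)" for x
  define E where "E k H r = (((k r)\<^sup>2 + (H r)\<^sup>2 / r\<^sup>2) powr (p / 2) + 1 / 2 * (1 - (H r)\<^sup>2)\<^sup>2) * r"
    for k H :: "real \<Rightarrow> real" and r :: real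
  let ?D = "\<lambda>r. ((F r)\<^sup>2 - (G r)\<^sup>2)\<^sup>2 / 4 * r"
  have [measurable]: "F \<in> borel_measurable (lebesgue_on {0<..})" "G \<in> borel_measurable (lebesgue_on {0<..})"
    using primitive_of_continuous[OF F] primitive_of_continuous[OF G]
    by (auto intro: continuous_imp_measurable_on_sets_lebesgue)
  have [measurable]: "k \<in> borel_measurable (lebesgue_on {0<..})" "l \<in> borel_measurable (lebesgue_on {0<..})"
    using k l by (auto simp: locally_Lp_def)
  have [measurable]: "(\<lambda>x. x :: real) \<in> borel_measurable (lebesgue_on {0<..})"
    by (rule continuous_imp_measurable_on_sets_lebesgue) auto
  have [measurable]: "q \<in> borel_measurable (lebesgue_on {0<..})"
    unfolding q_def quadratic_mean_deriv_def[abs_def] by measurable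
  have [measurable]: "h \<in> borel_measurable (lebesgue_on {0<..})"
    unfolding h_def[abs_def] by measurable
  have [measurable]: "E k' H \<in> borel_measurable (lebesgue_on {0<..})"
    if [measurable]: "k' \<in> borel_measurable (lebesgue_on {0<..})" "H \<in> borel_measurable (lebesgue_on {0<..})"
    for k' H
    unfolding E_def[abs_def] by measurable
  have E0: "E k' H r \<ge> 0" if "r > 0" for k' H and r :: real
    using that by (simp add: E_def)
  have "2 * energy p q h + (\<integral>\<^sup>+ r. ennreal (?D r) \<partial>lebesgue_on {0<..})
      = (\<integral>\<^sup>+ r. 2 * ennreal (E q h r) + ennreal (?D r) \<partial>lebesgue_on {0<..})"
    unfolding energy_def E_def[symmetric]
    by (subst nn_integral_add) (auto simp: nn_integral_cmult)
  also have "\<dots> \<le> (\<integral>\<^sup>+ r. ennreal (E k F r) + ennreal (E l G r) \<partial>lebesgue_on {0<..})"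
  proof (rule nn_integral_mono)
    fix r :: real assume "r \<in> space (lebesgue_on {0<..})"
    then have r: "r > 0" by simp
    have "2 * E q h r + ?D r \<le> E k F r + E l G r"
      using density_quadratic_mean_le[OF assms(1) r, of F k G l] by (simp add: E_def q_def h_def)
    moreover have "2 * ennreal (E q h r) + ennreal (?D r) = ennreal (2 * E q h r + ?D r)"
      using E0[OF r] r by (simp add: ennreal_plus ennreal_mult)
    moreover have "ennreal (E k F r) + ennreal (E l G r) = ennreal (E k F r + E l G r)"
      using E0[OF r] by (simp add: ennreal_plus)
    ultimately show "2 * ennreal (E q h r) + ennreal (?D r) \<le> ennreal (E k F r) + ennreal (E l G r)"
      by (simp only: ennreal_leI)
  qed
  also have "\<dots> = energy p k F + energy p l G"
    unfolding energy_def E_def[symmetric] by (rule nn_integral_add) auto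
  finally show ?thesis
    unfolding q_def h_def[abs_def] .
qed

section \<open>Existence of finite energy and uniqueness\<close>

text \<open>Without an element of finite energy, every element of \<open>X_p\<close> would be a
  minimizer. On (0, 1] the gradient term of min r 1 is constant; beyond 1 the potential vanishes and
  only r^(1 - p) is left.\<close>

lemma finite_energy_exists:
  fixes p :: real
  assumes "p > 2"
  obtains f where "f \<in> X_p p" "I_p p f < \<infinity>"
proof -
  define H :: "real \<Rightarrow> real" where "H r = min r 1" for r
  define k :: "real \<Rightarrow> real" where "k r = (if r \<le> 1 then 1 else 0)" for r
  have km: "k \<in> borel_measurable (lebesgue_on S)" for S
  proof -
    have "k \<in> borel_measurable borel" unfolding k_def[abs_def] by measurable
    then show ?thesis
      by (simp add: measurable_completion measurable_restrict_space1)
  qed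
  have bdd: "u absolutely_integrable_on {a..b}"
    if "u \<in> borel_measurable (lebesgue_on {a..b})" "\<And>x. \<bar>u x\<bar> \<le> 1" for u :: "real \<Rightarrow> real" and a b
    using that by (intro measurable_bounded_by_integrable_imp_absolutely_integrable[where g = "\<lambda>_. 1"]) auto
  have prim: "primitive_of k H"
  proof (rule primitive_ofI_has_integral)
    fix a b :: real assume ab: "0 < a" "a \<le> b"
    show "k absolutely_integrable_on {a..b}"
      by (rule bdd[OF km]) (auto simp: k_def)
    \<comment> \<open>The kink of min r 1 at r = 1 is the exceptional point of the fundamental
      theorem.\<close>
    show "(k has_integral (H b - H a)) {a..b}"
    proof (rule fundamental_theorem_of_calculus_interior_strong[of "{1}"])
      show "continuous_on {a..b} H"
        unfolding H_def by (intro continuous_intros)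
      show "(H has_vector_derivative k x) (at x)" if "x \<in> {a<..<b} - {1}" for x
      proof (cases "x < 1")
        case True
        have "((\<lambda>x. x) has_real_derivative k x) (at x)"
          using True by (auto simp: k_def)
        then have "(H has_real_derivative k x) (at x)"
          by (rule has_field_derivative_transform_within_open[where S = "{..<1}"])
            (use True in \<open>auto simp: H_def\<close>)
        then show ?thesis by (simp add: has_real_derivative_iff_has_vector_derivative)
      next
        case False
        have "((\<lambda>x. 1) has_real_derivative k x) (at x)"
          using False that by (auto simp: k_def)
        then have "(H has_real_derivative k x) (at x)"
          by (rule has_field_derivative_transform_within_open[where S = "{1<..}"])
            (use False that in \<open>auto simp: H_def\<close>)
        then show ?thesis by (simp add: has_real_derivative_iff_has_vector_derivative)
      qed
    qed (use ab in auto)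
  qed
  have "(\<lambda>x. \<bar>k x\<bar> powr p) = k"
    by (auto simp: k_def)
  then have "(\<lambda>x. \<bar>k x\<bar> powr p) absolutely_integrable_on {a..b}" for a b
    using bdd[OF km] by (auto simp: k_def)
  then have kLp: "k \<in> locally_Lp p {0<..}"
    by (simp add: locally_Lp_iff km)
  \<comment> \<open>Here p > 2 is decisive: the exponent 1 - p is below -1.\<close>
  have tail: "(\<integral>\<^sup>+ r. ennreal (indicator {1..} r * r powr (1 - p)) \<partial>lebesgue) < \<infinity>"
  proof -
    have "((\<lambda>r. r powr (1 - p)) has_integral - (1 powr (1 - p + 1)) / (1 - p + 1)) {1..}"
      using assms by (intro has_integral_powr_to_inf) auto
    from nn_integral_has_integral_lebesgue[OF _ this]
    have "(\<integral>\<^sup>+ r. ennreal (indicator {1..} r * r powr (1 - p)) \<partial>lborel) = ennreal (- (1 powr (1 - p + 1)) / (1 - p + 1))"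
      by simp
    then show ?thesis by (simp add: nn_integral_completion)
  qed
  have "energy p k H \<le> (\<integral>\<^sup>+ r. ennreal (2 powr (p / 2) + 1) * indicator {0..1} r
      + ennreal (indicator {1..} r * r powr (1 - p)) \<partial>lebesgue_on {0<..})"
    unfolding energy_def
  proof (rule nn_integral_mono)
    fix r :: real assume "r \<in> space (lebesgue_on {0<..})"
    then have r: "r > 0" by simp
    show "ennreal ((((k r)\<^sup>2 + (H r)\<^sup>2 / r\<^sup>2) powr (p / 2) + 1 / 2 * (1 - (H r)\<^sup>2)\<^sup>2) * r)
      \<le> ennreal (2 powr (p / 2) + 1) * indicator {0..1} r + ennreal (indicator {1..} r * r powr (1 - p))"
    proof (cases "r \<le> 1")
      case True
      \<comment> \<open>Both the derivative and H/r equal 1 on (0, 1], hence the base 2 of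
        \<open>2 powr (p / 2)\<close>; the summand 1 generously covers the potential.\<close>
      have "(1 - r\<^sup>2)\<^sup>2 \<le> 1"
        using True r by (intro power_le_one) (auto simp: power_le_one)
      then have "(2 powr (p / 2) + 1 / 2 * (1 - r\<^sup>2)\<^sup>2) * r \<le> (2 powr (p / 2) + 1) * 1"
        using True r by (intro mult_mono add_mono) (auto intro!: add_nonneg_nonneg)
      then have "ennreal ((((k r)\<^sup>2 + (H r)\<^sup>2 / r\<^sup>2) powr (p / 2) + 1 / 2 * (1 - (H r)\<^sup>2)\<^sup>2) * r)
        \<le> ennreal (2 powr (p / 2) + 1)"
        using True r by (intro ennreal_leI) (simp add: k_def H_def)
      also have "\<dots> \<le> ennreal (2 powr (p / 2) + 1) * indicator {0..1} r + ennreal (indicator {1..} r * r powr (1 - p))"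
        using True r by simp
      finally show ?thesis .
    next
      case False
      have "(1 / r\<^sup>2) powr (p / 2) = r powr (- p)"
        using r by (simp add: powr_divide powr_minus_divide powr_powr flip: powr_numeral)
      then have "(((k r)\<^sup>2 + (H r)\<^sup>2 / r\<^sup>2) powr (p / 2) + 1 / 2 * (1 - (H r)\<^sup>2)\<^sup>2) * r = r powr (1 - p)"
        using False r by (simp add: k_def H_def powr_diff powr_minus_divide)
      then show ?thesis
        using False by simp
    qed
  qed
  also have "\<dots> \<le> (\<integral>\<^sup>+ r. ennreal (2 powr (p / 2) + 1) * indicator {0..1} r
      + ennreal (indicator {1..} r * r powr (1 - p)) \<partial>lebesgue)"
    by (subst nn_integral_restrict_space) (auto intro!: nn_integral_mono simp: indicator_def)
  also have "\<dots> = ennreal (2 powr (p / 2) + 1) * emeasure lebesgue {0..1::real}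
      + (\<integral>\<^sup>+ r. ennreal (indicator {1..} r * r powr (1 - p)) \<partial>lebesgue)"
  proof (subst nn_integral_add)
    have "(\<lambda>r::real. ennreal (2 powr (p / 2) + 1) * indicator {0..1} r) \<in> borel_measurable lborel"
      by measurable
    then show "(\<lambda>r::real. ennreal (2 powr (p / 2) + 1) * indicator {0..1} r) \<in> borel_measurable lebesgue"
      by (rule measurable_completion)
    have "(\<lambda>r::real. ennreal (indicator {1..} r * r powr (1 - p))) \<in> borel_measurable lborel"
      by measurable
    then show "(\<lambda>r::real. ennreal (indicator {1..} r * r powr (1 - p))) \<in> borel_measurable lebesgue"
      by (rule measurable_completion)
  qed (simp add: nn_integral_cmult_indicator)
  also have "\<dots> < \<infinity>"
    using tail by (simp add: ennreal_mult_less_top)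
  finally have fin: "energy p k H < \<infinity>" .
  show ?thesis
    using primitive_in_X_p[OF _ prim kLp fin] fin assms by (intro that[of H]) auto
qed

theorem proposition2p2:
  fixes p :: real and f g :: "real \<Rightarrow> real"
  assumes "p > 2"
    and "nonneg_minimizer p f"
    and "nonneg_minimizer p g"
  shows "AE r in lebesgue_on {0<..}. f r = g r"
proof -
  have f: "f \<in> X_p p" "\<And>h. h \<in> X_p p \<Longrightarrow> I_p p f \<le> I_p p h" "AE r in lebesgue_on {0<..}. 0 \<le> f r"
    and g: "g \<in> X_p p" "\<And>h. h \<in> X_p p \<Longrightarrow> I_p p g \<le> I_p p h" "AE r in lebesgue_on {0<..}. 0 \<le> g r"
    using assms(2,3) by (auto simp: nonneg_minimizer_def is_arg_min_linorder)
  obtain u where "u \<in> X_p p" "I_p p u < \<infinity>"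
    using finite_energy_exists[OF assms(1)] .
  then have fin: "I_p p f < \<infinity>" "I_p p g < \<infinity>"
    using f(2) g(2) by (auto intro: le_less_trans)
  obtain k F where F: "primitive_of k F" "AE x in lebesgue_on {0<..}. f x = F x"
    "k \<in> locally_Lp p {0<..}" "I_p p f = energy p k F"
    using X_p_primitive[OF f(1)] .
  obtain l G where G: "primitive_of l G" "AE x in lebesgue_on {0<..}. g x = G x"
    "l \<in> locally_Lp p {0<..}" "I_p p g = energy p l G"
    using X_p_primitive[OF g(1)] .
  define h where "h x = sqrt (((F x)\<^sup>2 + (G x)\<^sup>2) / 2)" for x
  define q where "q = quadratic_mean_deriv F k G l"
  define d where "d = (\<integral>\<^sup>+ r. ennreal (((F r)\<^sup>2 - (G r)\<^sup>2)\<^sup>2 / 4 * r) \<partial>lebesgue_on {0<..})"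
  have le: "2 * energy p q h + d \<le> I_p p f + I_p p g"
    using energy_quadratic_mean_le[OF _ F(1) G(1) F(3) G(3)] assms(1)
    unfolding F(4) G(4) q_def h_def[abs_def] d_def by simp
  have "energy p q h \<le> 2 * energy p q h + d"
    by (simp add: mult_2 add.assoc)
  also have "\<dots> < \<infinity>"
    using le fin by (metis le_less_trans ennreal_add_less_top infinity_ennreal_def)
  finally have qfin: "energy p q h < \<infinity>" .
  have prim: "primitive_of q h"
    unfolding q_def h_def[abs_def] by (rule primitive_of_quadratic_mean[OF F(1) G(1)])
  have qLp: "q \<in> locally_Lp p {0<..}"
    unfolding q_def using assms(1) by (intro quadratic_mean_deriv_locally_Lp F G) auto
  have h: "h \<in> X_p p" "I_p p h = energy p q h"
    using primitive_in_X_p[OF _ prim qLp qfin] assms(1) by auto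
  \<comment> \<open>Minimality bounds both energies on the right by that of \<open>h\<close>.
    Cancelling the doubled energy to get d = 0 is legitimate only because it is finite.\<close>
  have "2 * energy p q h + d \<le> 2 * energy p q h + 0"
    using le f(2)[OF h(1)] g(2)[OF h(1)] unfolding h(2)
    by (metis add.right_neutral add_mono mult_2 order_trans)
  then have "d = 0"
    using qfin by (auto simp: ennreal_add_left_cancel_le ennreal_mult_eq_top_iff)
  have m: "(\<lambda>r. ennreal (((F r)\<^sup>2 - (G r)\<^sup>2)\<^sup>2 / 4 * r)) \<in> borel_measurable (lebesgue_on {0<..})"
    by (intro measurable_compose[OF _ measurable_ennreal] continuous_imp_measurable_on_sets_lebesgue
        continuous_intros primitive_of_continuous[OF F(1)] primitive_of_continuous[OF G(1)]) auto
  have "AE r in lebesgue_on {0<..}. ennreal (((F r)\<^sup>2 - (G r)\<^sup>2)\<^sup>2 / 4 * r) = 0"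
    using \<open>d = 0\<close> unfolding d_def nn_integral_0_iff_AE[OF m] .
  \<comment> \<open>Positivity of the weight r is needed to conclude that the squared difference
    itself vanishes.\<close>
  moreover have "AE r in lebesgue_on {0<..}. 0 < r"
    by (rule AE_I2) simp
  ultimately show ?thesis
    using F(2) G(2) f(3) g(3)
  proof eventually_elim
    case (elim r)
    then have "(F r)\<^sup>2 = (G r)\<^sup>2"
      by (simp add: ennreal_eq_0_iff mult_le_0_iff)
    then show ?case
      \<comment> \<open>The signs of \<open>f\<close> and \<open>g\<close> carry over to
        \<open>F\<close> and \<open>G\<close> at almost every point, so equal squares mean equal
        values.\<close>
      using elim by (simp add: power2_eq_iff_nonneg)
  qed
qed

end
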